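(* For every positive integer $N$, for Lebesgue almost every $x\in I=[0,1)$, the following hold. (1) For $r\ge1$, $K_{N,r}(x)=+\infty$. (2) For $r<1$ with $r\neq0$, $K_{N,r}(x)$ equals the constant $$K_{N,r}:=\left(\sum_{k=N}^\infty k^r\,\frac{\ln(1+\frac1k)-\ln(1+\frac1{k+1})}{\ln(1+\frac1N)}\right)^{\frac1r},$$ and these constants satisfy $$\lim_{N\to\infty}\frac{K_{N,r}}{N}=(1-r)^{-\frac1r}.$$ (3) $K_N(x)$ equals the constant $$K_N:=\prod_{k=N}^\infty\left(\frac{(k+1)^2}{k(k+2)}\right)^{\frac{\ln k}{\ln(N+1)-\ln N}},$$ and these constants satisfy $$\lim_{N\to\infty}\frac{K_N}{N}=e.$$
   Context: For a positive integer $N$, $T_N:I\to I$, $I=[0,1)$, is defined by $T_N(0)=0$ and $T_N(x)=\{N/x\}$ (fractional part) for $x\neq0$. The $N$-continued fraction expansion of $x\in I$ is $x=[a_1,a_2,\dots]_N=\cfrac{N}{a_1+\cfrac{N}{a_2+\ddots}}$, where $a_k=\lfloor N/T_N^{k-1}(x)\rfloor$, with $a_k=\infty$ if $T_N^{k-1}(x)=0$ (which happens for some $k$ only if $x$ is rational). The Hölder means of the coefficients of $x=[a_1,a_2,\dots]_N$ are, provided the limits exist (possibly $+\infty$): for real $r\neq0$, $$K_{N,r}(x)=\lim_{n\to\infty}\left(\frac1n\sum_{j=1}^n a_j^r\right)^{\frac1r},$$ and, for $r=0$, $$K_N(x)=K_{N,0}(x)=\lim_{n\to\infty}\sqrt[n]{\prod_{j=1}^n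 a_j}.$$ *)

theory Defs
  imports "HOL-Analysis.Analysis"
begin

definition ncf_map :: "nat \<Rightarrow> real \<Rightarrow> real" where
  "ncf_map N x = (if x = 0 then 0 else frac (real N / x))"

text \<open>The digits are indexed from \<open>k = 1\<close>; the value at \<open>k = 0\<close> is meaningless and never used.\<close>
definition ncf_digit :: "nat \<Rightarrow> real \<Rightarrow> nat \<Rightarrow> ereal" where
  "ncf_digit N x k =
     (let y = (ncf_map N ^^ (k - 1)) x
      in if y = 0 then \<infinity> else ereal (of_int \<lfloor>real N / y\<rfloor>))"

text \<open>Real powers on \<open>[0, \<infinity>]\<close>, needed because digits (and hence means) may be infinite:
  \<open>\<infinity>\<^sup>r\<close> is \<open>\<infinity>\<close>, \<open>1\<close>, \<open>0\<close> for \<open>r > 0\<close>, \<open>r = 0\<close>, \<open>r < 0\<close>, and \<open>0\<^sup>r = \<infinity>\<close> for \<open>r < 0\<close>.\<close>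
definition ereal_powr :: "ereal \<Rightarrow> real \<Rightarrow> ereal" where
  "ereal_powr a r =
     (if a = \<infinity> then (if r > 0 then \<infinity> else if r = 0 then 1 else 0)
      else if a = 0 \<and> r < 0 then \<infinity>
      else ereal (real_of_ereal a powr r))"

definition holder_mean :: "nat \<Rightarrow> real \<Rightarrow> real \<Rightarrow> nat \<Rightarrow> ereal" where
  "holder_mean N r x n =
     (if r = 0 then ereal_powr (\<Prod>j=1..n. ncf_digit N x j) (1 / real n)
      else ereal_powr ((\<Sum>j=1..n. ereal_powr (ncf_digit N x j) r) / ereal (real n)) (1 / r))"

definition holder_const :: "nat \<Rightarrow> real \<Rightarrow> real" where
  "holder_const N r =
     (\<Sum>i. let k = real (N + i)
           in k powr r * ((ln (1 + 1 / k) - ln (1 + 1 / (k + 1))) / ln (1 + 1 / real N)))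
     powr (1 / r)"

definition geom_const :: "nat \<Rightarrow> real" where
  "geom_const N =
     (\<Prod>i. let k = real (N + i)
           in ((k + 1)\<^sup>2 / (k * (k + 2))) powr (ln k / (ln (real N + 1) - ln (real N))))"

end

theory Submission
  imports Defs "HOL-Probability.Probability_Measure" "HOL-Real_Asymp.Real_Asymp"
    "HOL-Library.Discrete_Functions"
begin

text \<open>The digits of \<open>x\<close> are read off its orbit under the map \<open>T\<close> that sends \<open>x\<close> to the fractional part
  of \<open>N / x\<close>: for almost every \<open>x\<close> and every \<open>k \<ge> 1\<close>, the \<open>j\<close>-th digit is at least \<open>k\<close> exactly if
  \<open>T\<^sup>j\<^sup>-\<^sup>1 x \<le> N / k\<close>. The map preserves the probability measure \<open>\<mu>\<close> with density
  \<open>1 / (ln (1 + 1/N) (N + x))\<close> on \<open>[0, 1]\<close>, which has the same null sets as Lebesgue measure there and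
  gives \<open>{..N / k}\<close> the mass \<open>ln (1 + 1/k) / ln (1 + 1/N)\<close> if \<open>k \<ge> N\<close>. So everything comes down to a
  law of large numbers for the orbit.

  A quantitative mixing estimate replaces the ergodic theorem. Let \<open>P\<close> be the transfer operator, the
  dual of \<open>f \<mapsto> f \<circ> T\<close> in \<open>L\<^sup>2(\<mu>)\<close>. It sends monotone functions to monotone functions of the opposite
  direction, so that the oscillation of \<open>P f\<close> is seen at the end points \<open>0\<close> and \<open>1\<close>; there the two
  series defining \<open>P f\<close> are proportional after a shift of the index and the removal of one term
  (\<open>transfer_endpoints\<close>), which shows that \<open>P\<close> at least halves the oscillation
  (\<open>monotone_osc_transfer\<close>). Hence correlations of monotone functions along the orbit decay like
  \<open>2\<^sup>-\<^sup>n\<close> (\<open>decay_of_correlations\<close>), and the variance of a Birkhoff sum of length \<open>n\<close> is \<open>O(n)\<close>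
  (\<open>variance_birkhoff_sum_le\<close>). Summing second moments along a sparse subsequence and interpolating
  gives almost everywhere: every \<open>k\<close> has its expected frequency among the digits (\<open>AE_frequency\<close>),
  and the averages of \<open>a\<^sub>j\<^sup>s\<close> stay bounded for every \<open>s < 1\<close> (\<open>AE_power_sums_bounded\<close>).

  These countably many properties of one point \<open>x\<close> settle all exponents \<open>r\<close> simultaneously. For
  \<open>r < 1\<close> choose \<open>s\<close> between \<open>r\<close> and \<open>1\<close>: the bound for \<open>s\<close> makes the contribution of large digits to
  the average of \<open>a\<^sub>j\<^sup>r\<close> uniformly small, and the frequencies determine the rest; the geometric mean is
  treated in the same way through logarithms. For \<open>r \<ge> 1\<close> the average dominates the partial sums of
  the harmonic-like series of the tail probabilities, which diverges.

  The asymptotics of the constants as \<open>N\<close> grows come from comparing tails of series whose terms have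
  a limiting ratio (\<open>tail_sum_ratio\<close>), the comparison series being telescoping.\<close>

section \<open>The invariant measure and its transfer operator\<close>

locale ncf =
  fixes N :: nat
  assumes N_pos: "N > 0"
begin

definition gauss_density :: "real \<Rightarrow> real" where
  "gauss_density x = indicator {0..1} x / (ln (1 + 1 / N) * (real N + x))"

definition gauss_measure :: "real measure" ("\<mu>") where
  "\<mu> = density lborel (\<lambda>x. ennreal (gauss_density x))"

text \<open>The inverse branches of the map are indexed by \<open>i = a - N\<close>, where \<open>a\<close> is the digit, so that every
  natural number is an index. The weight of a branch is the conditional probability under the
  invariant measure that the preimage of \<open>y\<close> has digit \<open>N + i\<close>; in particular the weights add up
  to \<open>1\<close>, and \<open>transfer\<close> is an averaging operator.\<close>

definition inv_branch :: "nat \<Rightarrow> real \<Rightarrow> real" where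
  "inv_branch i y = real N / (real N + real i + y)"

definition weight :: "nat \<Rightarrow> real \<Rightarrow> real" where
  "weight i y = (real N + y) / ((real N + real i + y) * (real N + real i + y + 1))"

definition transfer :: "(real \<Rightarrow> real) \<Rightarrow> real \<Rightarrow> real" where
  "transfer f y = (\<Sum>i. weight i y * f (inv_branch i y))"

abbreviation T :: "real \<Rightarrow> real" where "T \<equiv> ncf_map N"

lemma ln_pos: "ln (1 + 1 / real N) > 0"
  using N_pos by (intro ln_gt_zero) auto

lemma gauss_density_nonneg: "gauss_density x \<ge> 0"
  using ln_pos by (auto simp: gauss_density_def indicator_def)

lemma gauss_density_measurable [measurable]: "gauss_density \<in> borel_measurable borel"
  unfolding gauss_density_def by measurable

lemma space_\<mu> [simp]: "space \<mu> = UNIV" and sets_\<mu> [simp, measurable_cong]: "sets \<mu> = sets borel"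
  by (auto simp: gauss_measure_def)

lemma T_measurable [measurable]: "T \<in> borel_measurable borel"
proof -
  have "T = (\<lambda>x. if x = 0 then 0 else N / x - of_int \<lfloor>N / x\<rfloor>)"
    by (auto simp: ncf_map_def frac_def)
  then show ?thesis by simp
qed

lemma inv_branch_measurable [measurable]: "inv_branch i \<in> borel_measurable borel"
  unfolding inv_branch_def by measurable

lemma weight_measurable [measurable]: "weight i \<in> borel_measurable borel"
  unfolding weight_def by measurable

lemma transfer_measurable [measurable]:
  assumes [measurable]: "f \<in> borel_measurable borel"
  shows "transfer f \<in> borel_measurable borel"
  unfolding transfer_def by measurable

text \<open>Substitution along one branch. The branch is decreasing, so it is composed with a reflection
  to obtain an increasing substitution.\<close>

lemma nn_integral_inv_branch:
  fixes a :: real and f :: "real \<Rightarrow> real"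
  assumes [measurable]: "f \<in> borel_measurable borel" and a: "a > 0"
  shows "(\<integral>\<^sup>+x. f x * indicator {N / (a + 1)..N / a} x \<partial>lborel) =
         (\<integral>\<^sup>+y. f (N / (a + y)) * (N / (a + y)\<^sup>2) * indicator {0..1} y \<partial>lborel)"
proof -
  define g where "g = (\<lambda>y. - (N / (a + y)))"
  have "(\<integral>\<^sup>+x. f x * indicator {N / (a + 1)..N / a} x \<partial>lborel) =
        (\<integral>\<^sup>+x. f (- x) * indicator {N / (a + 1)..N / a} (- x) \<partial>lborel)"
    by (subst nn_integral_real_affine[where c="-1" and t=0]) auto
  also have "\<dots> = (\<integral>\<^sup>+x. f (- x) * indicator {g 0..g 1} x \<partial>lborel)"
    by (intro nn_integral_cong) (auto simp: g_def indicator_def)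
  also have "\<dots> = (\<integral>\<^sup>+y. f (- g y) * (N / (a + y)\<^sup>2) * indicator {0..1} y \<partial>lborel)"
  proof (rule nn_integral_substitution)
    show "set_borel_measurable borel {g 0..g 1} (\<lambda>x. f (- x))"
      unfolding set_borel_measurable_def by measurable
    show "(g has_real_derivative N / (a + y)\<^sup>2) (at y)" if "y \<in> {0..1}" for y
      unfolding g_def using that a
      by (auto intro!: derivative_eq_intros simp: power2_eq_square)
    show "continuous_on {0..1} (\<lambda>y. N / (a + y)\<^sup>2)"
      using a by (auto intro!: continuous_intros)
  qed auto
  finally show ?thesis by (simp add: g_def)
qed

lemma branch_domains:
  "(\<Union>i. {N / (N + i + 1)<..N / (N + i)}) = {0<..(1::real)}"
  "disjoint_family (\<lambda>i. {real N / (N + i + 1)<..N / (N + i)})"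
proof -
  show "(\<Union>i. {N / (N + i + 1)<..N / (N + i)}) = {0<..(1::real)}"
  proof (intro equalityI subsetI)
    fix x :: real assume "x \<in> (\<Union>i. {N / (N + i + 1)<..N / (N + i)})"
    then obtain i where i: "N / (N + i + 1) < x" "x \<le> N / (N + i)" by auto
    have "0 \<le> real N / (N + i + 1)" "real N / (N + i) \<le> 1" using N_pos by (auto simp: field_simps)
    then show "x \<in> {0<..1}" unfolding greaterThanAtMost_iff using i by linarith
  next
    fix x :: real assume x: "x \<in> {0<..1}"
    define i where "i = nat \<lfloor>N / x\<rfloor> - N"
    have "real N \<le> N / x" using x by (auto simp: field_simps mult_left_le_one_le)
    then have "N \<le> nat \<lfloor>N / x\<rfloor>" by (simp add: le_nat_iff le_floor_iff)
    then have e: "real N + i = of_int \<lfloor>N / x\<rfloor>" unfolding i_def using x by (simp add: of_nat_diff)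
    have "real N + i \<le> N / x" "N / x < real N + i + 1" unfolding e by linarith+
    then have "x \<in> {N / (N + i + 1)<..N / (N + i)}"
      using x N_pos by (auto simp: field_simps)
    then show "x \<in> (\<Union>i. {N / (N + i + 1)<..N / (N + i)})" by blast
  qed
  show "disjoint_family (\<lambda>i. {real N / (N + i + 1)<..N / (N + i)})"
    unfolding disjoint_family_on_def
  proof (intro ballI impI)
    have *: "{real N / (N + m + 1)<..N / (N + m)} \<inter> {real N / (N + n + 1)<..N / (N + n)} = {}" 
      if "m < n" for m n :: nat
    proof -
      have "real m + 1 \<le> real n" using that by simp
      then have "real N / (N + n) \<le> N / (N + m + 1)"
        using N_pos by (intro divide_left_mono) auto
      then show ?thesis by auto
    qed
    fix m n :: nat assume "m \<noteq> n"
    then show "{real N / (N + m + 1)<..N / (N + m)} \<inter> {real N / (N + n + 1)<..N / (N + n)} = {}"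
      using *[of m n] *[of n m] by (cases "m < n") auto
  qed
qed

text \<open>Splitting \<open>(0, 1]\<close> into the domains of the branches and substituting in each piece expresses an
  integral as an integral over the weighted preimages. Applied to \<open>f \<cdot> (g \<circ> T)\<close> it becomes the duality
  between \<open>transfer\<close> and composition with \<open>T\<close>; applied to \<open>g \<circ> T\<close> it is the invariance of \<open>\<mu>\<close>.\<close>

lemma nn_integral_transfer:
  assumes [measurable]: "f \<in> borel_measurable borel" and f: "\<And>x. f x \<ge> 0"
  shows "(\<integral>\<^sup>+x. f x \<partial>\<mu>) = (\<integral>\<^sup>+y. (\<Sum>i. ennreal (weight i y * f (inv_branch i y))) \<partial>\<mu>)"
proof -
  let ?B = "\<lambda>i::nat. {real N / (N + i + 1)<..N / (N + i)}"
  let ?h = "\<lambda>x. gauss_density x * f x"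
  have [measurable]: "?h \<in> borel_measurable borel" by measurable
  have h0: "?h x \<ge> 0" for x using f gauss_density_nonneg by auto
  have branch: "(\<integral>\<^sup>+x\<in>?B i. ?h x \<partial>lborel) =
      (\<integral>\<^sup>+y. gauss_density y * (weight i y * f (inv_branch i y)) \<partial>lborel)" for i
  proof -
    let ?a = "real N + i"
    have "(\<integral>\<^sup>+x\<in>?B i. ?h x \<partial>lborel) = (\<integral>\<^sup>+x. ennreal (?h x * indicator {N / (?a + 1)..N / ?a} x) \<partial>lborel)"
      using AE_lborel_singleton[of "real N / (?a + 1)"]
      by (intro nn_integral_cong_AE, eventually_elim) (auto simp: indicator_def add_ac)
    also have "\<dots> = (\<integral>\<^sup>+y. ?h (N / (?a + y)) * (N / (?a + y)\<^sup>2) * indicator {0..1} y \<partial>lborel)"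
      using N_pos by (intro nn_integral_inv_branch) auto
    \<comment> \<open>The weight is the Jacobian of the branch times the quotient of the two densities.\<close>
    also have "\<dots> = (\<integral>\<^sup>+y. gauss_density y * (weight i y * f (inv_branch i y)) \<partial>lborel)"
    proof (intro nn_integral_cong arg_cong[where f=ennreal])
      fix y :: real
      show "?h (N / (?a + y)) * (N / (?a + y)\<^sup>2) * indicator {0..1} y =
            gauss_density y * (weight i y * f (inv_branch i y))"
      proof (cases "y \<in> {0..1}")
        case True
        define b where "b = ?a + y"
        define l where "l = ln (1 + 1 / real N)"
        have b: "b > 0" "b \<ge> N" and l: "l > 0" and n: "real N > 0" and y: "N + y > 0"
          unfolding b_def l_def using True N_pos ln_pos by auto
        have "N / b \<in> {0..1}" using b by auto
        then have "gauss_density (N / b) * (N / b\<^sup>2) = 1 / (l * (N + N / b)) * (N / b\<^sup>2)"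
          by (simp add: gauss_density_def l_def)
        also have "\<dots> = 1 / (l * (N + y)) * ((N + y) / (b * (b + 1)))"
        proof -
          have "N + N / b = N * (b + 1) / b" using b by (simp add: field_simps)
          then show ?thesis using b l n y by (simp add: power2_eq_square)
        qed
        also have "\<dots> = gauss_density y * weight i y"
          using True by (simp add: gauss_density_def l_def weight_def b_def)
        finally have e: "gauss_density (N / b) * (N / b\<^sup>2) = gauss_density y * weight i y" .
        have "?h (N / b) * (N / b\<^sup>2) = (gauss_density (N / b) * (N / b\<^sup>2)) * f (N / b)"
          by simp
        then show ?thesis unfolding e using True by (simp add: b_def inv_branch_def)
      qed (auto simp: gauss_density_def)
    qed
    finally show ?thesis .
  qed
  have "(\<integral>\<^sup>+x. f x \<partial>\<mu>) = (\<integral>\<^sup>+x. ?h x \<partial>lborel)"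
    unfolding gauss_measure_def
    by (subst nn_integral_density) (auto simp: ennreal_mult f gauss_density_nonneg)
  also have "\<dots> = (\<integral>\<^sup>+x\<in>{0<..1}. ?h x \<partial>lborel)"
    using AE_lborel_singleton[of "0::real"]
    by (intro nn_integral_cong_AE, eventually_elim) (auto simp: gauss_density_def indicator_def)
  also have "\<dots> = (\<Sum>i. \<integral>\<^sup>+x\<in>?B i. ?h x \<partial>lborel)"
    unfolding branch_domains(1)[symmetric]
    by (rule nn_integral_disjoint_family) (use branch_domains(2) in auto)
  also have "\<dots> = (\<Sum>i. \<integral>\<^sup>+y. gauss_density y * (weight i y * f (inv_branch i y)) \<partial>lborel)"
    by (simp only: branch)
  also have "\<dots> =
      (\<integral>\<^sup>+y. (\<Sum>i. ennreal (gauss_density y * (weight i y * f (inv_branch i y)))) \<partial>lborel)"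
    by (subst nn_integral_suminf) auto
  also have "\<dots> = (\<integral>\<^sup>+y. (\<Sum>i. ennreal (weight i y * f (inv_branch i y))) \<partial>\<mu>)"
    unfolding gauss_measure_def
    by (subst nn_integral_density)
       (auto simp: ennreal_mult' gauss_density_nonneg intro!: nn_integral_cong)
  finally show ?thesis .
qed

section \<open>Contraction of the oscillation of monotone functions\<close>

lemma T_range: "0 \<le> T x" "T x < 1"
  by (auto simp: ncf_map_def frac_lt_1)

lemma T_inv_branch:
  assumes "0 \<le> y" "y < 1"
  shows "T (inv_branch i y) = y"
proof -
  have p: "real N + i + y > 0" using N_pos assms by (intro add_pos_nonneg) auto
  then have "T (inv_branch i y) = frac (y + of_int (int (N + i)))"
    using N_pos by (simp add: ncf_map_def inv_branch_def add_ac)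
  also have "\<dots> = y" using assms by (subst frac_unique_iff) auto
  finally show ?thesis .
qed

lemma inv_branch_range:
  assumes "0 \<le> y"
  shows "0 \<le> inv_branch i y" "inv_branch i y \<le> 1"
  using assms N_pos by (auto simp: inv_branch_def divide_le_eq)

lemma weight_nonneg: "0 \<le> y \<Longrightarrow> 0 \<le> weight i y"
  by (auto simp: weight_def)

lemma sum_weight:
  assumes "0 \<le> y"
  shows "(\<Sum>i<n. weight i y) = 1 - (real N + y) / (real N + n + y)"
proof (induction n)
  case 0
  then show ?case using N_pos assms by simp
next
  case (Suc n)
  define b where "b = real N + n + y"
  have b: "b > 0" using N_pos assms unfolding b_def by (intro add_pos_nonneg) auto
  have "(\<Sum>i<Suc n. weight i y) = 1 - (real N + y) / b + (real N + y) / (b * (b + 1))"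
    using Suc by (simp add: weight_def b_def)
  also have "\<dots> = 1 - (real N + y) / (b + 1)"
    using b by (simp add: divide_simps) (simp add: algebra_simps)
  finally show ?case by (simp add: b_def add_ac)
qed

lemma weight_sums_1:
  assumes "0 \<le> y"
  shows "(\<lambda>i. weight i y) sums 1"
proof -
  have "(\<lambda>n. 1 - (real N + y) / (real N + n + y)) \<longlonglongrightarrow> 1" by real_asymp
  then show ?thesis unfolding sums_def using sum_weight[OF assms] by simp
qed

lemma summable_transfer:
  assumes "0 \<le> y" and f: "\<And>x. x \<in> {0..1} \<Longrightarrow> \<bar>f x\<bar> \<le> M"
  shows "summable (\<lambda>i. weight i y * f (inv_branch i y))"
proof (rule summable_comparison_test')
  show "summable (\<lambda>i. weight i y * M)"
    using weight_sums_1[OF assms(1)] by (intro summable_mult2) (auto simp: sums_iff)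
  show "norm (weight i y * f (inv_branch i y)) \<le> weight i y * M" for i
    using f[of "inv_branch i y"] inv_branch_range[OF assms(1), of i] weight_nonneg[OF assms(1), of i]
    by (auto simp: abs_mult intro!: mult_left_mono)
qed

lemma transfer_range:
  assumes y: "0 \<le> y" and f: "\<And>x. x \<in> {0..1} \<Longrightarrow> l \<le> f x \<and> f x \<le> u"
  shows "l \<le> transfer f y" "transfer f y \<le> u"
proof -
  have s: "summable (\<lambda>i. weight i y * f (inv_branch i y))"
    by (rule summable_transfer[OF y, of _ "max \<bar>l\<bar> \<bar>u\<bar>"]) (use f in force)
  have c: "(\<Sum>i. weight i y * c) = c" "summable (\<lambda>i. weight i y * c)" for c
    using sums_mult2[OF weight_sums_1[OF y], of c] by (auto simp: sums_iff)
  have b: "weight i y * l \<le> weight i y * f (inv_branch i y)"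
    "weight i y * f (inv_branch i y) \<le> weight i y * u" for i
    using f[of "inv_branch i y"] inv_branch_range[OF y, of i] weight_nonneg[OF y, of i]
    by (auto intro!: mult_left_mono)
  show "l \<le> transfer f y"
    unfolding transfer_def using suminf_le[OF b(1) c(2) s] c(1)[of l] by simp
  show "transfer f y \<le> u"
    unfolding transfer_def using suminf_le[OF b(2) s c(2)] c(1)[of u] by simp
qed

lemma transfer_uminus:
  assumes "0 \<le> y" and "\<And>x. x \<in> {0..1} \<Longrightarrow> \<bar>f x\<bar> \<le> M"
  shows "transfer (\<lambda>x. - f x) y = - transfer f y"
  unfolding transfer_def using suminf_minus[OF summable_transfer[OF assms]] by simp

text \<open>The source of the contraction. Since \<open>inv_branch (Suc i) 0 = inv_branch i 1\<close>, the series at \<open>0\<close>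
  without its first term evaluates \<open>f\<close> at the same points as the series at \<open>1\<close>, with weights that are
  proportional by the factor \<open>N / (N + 1)\<close>.\<close>

lemma transfer_endpoints:
  assumes "\<And>x. x \<in> {0..1} \<Longrightarrow> \<bar>f x\<bar> \<le> M"
  shows "(real N + 1) * transfer f 0 = f 1 + N * transfer f 1"
proof -
  let ?t = "\<lambda>y i. weight i y * f (inv_branch i y)"
  have s: "summable (?t 0)" "summable (?t 1)"
    using summable_transfer[of _ f M] assms by auto
  have w: "?t 0 (Suc i) = N / (real N + 1) * ?t 1 i" for i
    using N_pos by (simp add: weight_def inv_branch_def add_ac)
  have "transfer f 0 = ?t 0 0 + (\<Sum>i. ?t 0 (Suc i))"
    unfolding transfer_def using suminf_split_head[OF s(1)] by simp
  also have "?t 0 0 = f 1 / (real N + 1)"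
    using N_pos by (simp add: weight_def inv_branch_def add_ac)
  also have "(\<Sum>i. ?t 0 (Suc i)) = N / (real N + 1) * transfer f 1"
    unfolding w transfer_def by (rule suminf_mult[OF s(2)])
  finally have "transfer f 0 = (f 1 + N * transfer f 1) / (real N + 1)"
    by (simp add: add_divide_distrib)
  then show ?thesis by simp
qed

text \<open>Summation by parts: nonnegative partial sums tested against a decreasing sequence. This is
  the discrete form of the fact that stochastic dominance is inherited by means of monotone
  functions.\<close>

lemma abel_sum_ge:
  fixes d c :: "nat \<Rightarrow> real"
  assumes "\<And>n. 0 \<le> (\<Sum>i<n. d i)" and "\<And>i. c (Suc i) \<le> c i"
  shows "(\<Sum>i<Suc n. d i) * c n \<le> (\<Sum>i<Suc n. d i * c i)"
proof (induction n)
  case (Suc n)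
  have "(\<Sum>i<Suc (Suc n). d i) * c (Suc n) = (\<Sum>i<Suc n. d i) * c (Suc n) + d (Suc n) * c (Suc n)"
    by (simp add: algebra_simps)
  also have "\<dots> \<le> (\<Sum>i<Suc n. d i) * c n + d (Suc n) * c (Suc n)"
    using assms(1)[of "Suc n"] assms(2)[of n] by (intro add_right_mono mult_left_mono) auto
  also have "\<dots> \<le> (\<Sum>i<Suc (Suc n). d i * c i)" using Suc by simp
  finally show ?case .
qed simp

text \<open>Raising \<open>y\<close> has two effects on the average \<open>transfer f y\<close>, and both lower it when \<open>f\<close> is increasing:
  each preimage \<open>inv_branch i y\<close> decreases, and the distribution of the digit shifts towards larger
  digits, that is towards smaller preimages. The sum with the weights of \<open>y\<close> and the preimages of the
  larger point \<open>z\<close> separates the two effects.\<close>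

lemma transfer_antimono:
  assumes f: "mono_on {0..1} f"
  shows "antimono_on {0..1} (transfer f)"
proof (rule monotone_onI)
  fix y z :: real assume yz: "y \<in> {0..1}" "z \<in> {0..1}" "y \<le> z"
  have fm: "f a \<le> f b" if "0 \<le> a" "a \<le> b" "b \<le> 1" for a b
    using mono_onD[OF f, of a b] that by auto
  define M where "M = max \<bar>f 0\<bar> \<bar>f 1\<bar>"
  have M: "\<bar>f x\<bar> \<le> M" if "x \<in> {0..1}" for x
    using fm[of 0 x] fm[of x 1] that unfolding M_def by auto
  have s: "summable (\<lambda>i. weight i v * f (inv_branch i u))" if "v \<in> {0..1}" "u \<in> {0..1}" for u v
  proof (rule summable_comparison_test')
    show "summable (\<lambda>i. weight i v * M)"
      using weight_sums_1[of v] that by (intro summable_mult2) (auto simp: sums_iff)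
    show "norm (weight i v * f (inv_branch i u)) \<le> weight i v * M" for i
      using M[of "inv_branch i u"] inv_branch_range[of u i] weight_nonneg[of v i] that
      by (auto simp: abs_mult intro!: mult_left_mono)
  qed
  define c where "c i = f (inv_branch i z) - f 0" for i
  have c0: "0 \<le> c i" for i
    unfolding c_def using fm[of 0 "inv_branch i z"] inv_branch_range[of z i] yz by auto
  have cdec: "c (Suc i) \<le> c i" for i
  proof -
    have "inv_branch (Suc i) z \<le> inv_branch i z"
      unfolding inv_branch_def using yz N_pos by (intro divide_left_mono mult_pos_pos) auto
    then show ?thesis
      unfolding c_def using fm inv_branch_range[of z] yz by auto
  qed
  define d where "d i = weight i y - weight i z" for i
  \<comment> \<open>Small digits are at least as likely under the weights of \<open>y\<close> as under those of \<open>z\<close>.\<close>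
  have d0: "0 \<le> (\<Sum>i<n. d i)" for n
  proof -
    have "(real N + y) / (real N + n + y) \<le> (real N + z) / (real N + n + z)"
      using yz N_pos by (simp add: divide_simps) (auto simp: algebra_simps intro: mult_right_mono)
    then show ?thesis unfolding d_def using yz by (simp add: sum_subtractf sum_weight)
  qed
  have sd: "summable (\<lambda>i. d i * c i)"
    unfolding d_def c_def using s[of y z] s[of z z] weight_sums_1[of y] weight_sums_1[of z] yz
    by (auto simp: algebra_simps sums_iff intro!: summable_diff summable_add summable_mult)
  have "0 \<le> (\<Sum>i. d i * c i)"
  proof (rule LIMSEQ_le_const)
    show "(\<lambda>n. \<Sum>i<Suc n. d i * c i) \<longlonglongrightarrow> (\<Sum>i. d i * c i)"
      using summable_LIMSEQ[OF sd] by (rule LIMSEQ_Suc)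
    have "0 \<le> (\<Sum>i<Suc n. d i * c i)" for n
      using abel_sum_ge[of d c n, OF d0 cdec] mult_nonneg_nonneg[OF d0[of "Suc n"] c0[of n]] by linarith
    then show "\<exists>n0. \<forall>n\<ge>n0. 0 \<le> (\<Sum>i<Suc n. d i * c i)" by blast
  qed
  also have "(\<Sum>i. d i * c i) = (\<Sum>i. weight i y * f (inv_branch i z) - weight i z * f (inv_branch i z) - (weight i y * f 0 - weight i z * f 0))"
    by (simp add: d_def c_def algebra_simps)
  also have "\<dots> = (\<Sum>i. weight i y * f (inv_branch i z)) - transfer f z - (f 0 - f 0)"
  proof -
    have w: "(\<lambda>i. weight i v * f 0) sums f 0" if "v \<in> {0..1}" for v
      using sums_mult2[OF weight_sums_1[of v], of "f 0"] that by simp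
    show ?thesis
      using sums_diff[OF sums_diff[OF summable_sums[OF s[of y z]] summable_sums[OF s[of z z]]] sums_diff[OF w[of y] w[of z]]] yz
      by (simp add: sums_iff transfer_def)
  qed
  finally have "transfer f z \<le> (\<Sum>i. weight i y * f (inv_branch i z))" by simp
  also have "\<dots> \<le> transfer f y"
    unfolding transfer_def
  proof (rule suminf_le)
    fix i
    have "inv_branch i z \<le> inv_branch i y"
      unfolding inv_branch_def using yz N_pos by (intro divide_left_mono mult_pos_pos add_pos_nonneg) auto
    then show "weight i y * f (inv_branch i z) \<le> weight i y * f (inv_branch i y)"
      using yz inv_branch_range[of z i] inv_branch_range[of y i] weight_nonneg[of y i]
      by (intro mult_left_mono fm) auto
  qed (use s yz in auto)
  finally show "transfer f z \<le> transfer f y" .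
qed

text \<open>The operator reverses monotonicity, so both directions are admitted in the class of functions
  that is iterated.\<close>

definition monotone_osc :: "real \<Rightarrow> (real \<Rightarrow> real) \<Rightarrow> bool" where
  "monotone_osc D f \<longleftrightarrow> (mono_on {0..1} f \<and> f 1 - f 0 \<le> D) \<or> (antimono_on {0..1} f \<and> f 0 - f 1 \<le> D)"

lemma monotone_osc_diff:
  assumes "monotone_osc D f" "y \<in> {0..1}" "z \<in> {0..1}"
  shows "\<bar>f y - f z\<bar> \<le> D"
  using assms(1) unfolding monotone_osc_def
proof (elim disjE conjE)
  assume "mono_on {0..1} f" and D: "f 1 - f 0 \<le> D"
  then have "f 0 \<le> f y" "f y \<le> f 1" "f 0 \<le> f z" "f z \<le> f 1"
    using assms(2,3) by (auto elim!: mono_onD)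
  then show ?thesis using D by auto
next
  assume "antimono_on {0..1} f" and D: "f 0 - f 1 \<le> D"
  then have "f y \<le> f 0" "f 1 \<le> f y" "f z \<le> f 0" "f 1 \<le> f z"
    using assms(2,3) unfolding monotone_on_def by auto
  then show ?thesis using D by auto
qed

text \<open>By \<open>transfer_endpoints\<close>, \<open>(N + 1) (P f 0 - P f 1) = f 1 - P f 1\<close>, and \<open>P f 1\<close> is an average of
  values of \<open>f\<close>; hence the oscillation shrinks by the factor \<open>N + 1 \<ge> 2\<close>.\<close>

lemma monotone_osc_transfer_mono:
  assumes f: "mono_on {0..1} f" "f 1 - f 0 \<le> D"
  shows "antimono_on {0..1} (transfer f)" "transfer f 0 - transfer f 1 \<le> D / 2"
proof -
  show "antimono_on {0..1} (transfer f)" by (rule transfer_antimono[OF f(1)])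
  have fb: "f 0 \<le> f x \<and> f x \<le> f 1" if "x \<in> {0..1}" for x
    using f(1) that by (auto elim!: mono_onD)
  have "(real N + 1) * transfer f 0 = f 1 + N * transfer f 1"
    by (rule transfer_endpoints[of _ "max \<bar>f 0\<bar> \<bar>f 1\<bar>"]) (use fb in force)
  then have e: "(real N + 1) * (transfer f 0 - transfer f 1) = f 1 - transfer f 1"
    by (simp add: algebra_simps)
  have "f 0 \<le> transfer f 1" using transfer_range(1)[of 1 "f 0" f "f 1"] fb by simp
  then have "(real N + 1) * (transfer f 0 - transfer f 1) \<le> D" unfolding e using f(2) by simp
  moreover have "0 \<le> transfer f 0 - transfer f 1"
    using monotone_onD[OF transfer_antimono[OF f(1)], of 0 1] by simp
  then have "2 * (transfer f 0 - transfer f 1) \<le> (real N + 1) * (transfer f 0 - transfer f 1)"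
    using N_pos by (intro mult_right_mono) auto
  ultimately show "transfer f 0 - transfer f 1 \<le> D / 2" by simp
qed

lemma monotone_osc_transfer:
  assumes "monotone_osc D f"
  shows "monotone_osc (D / 2) (transfer f)"
  using assms unfolding monotone_osc_def
proof (elim disjE conjE)
  assume f: "antimono_on {0..1} f" "f 0 - f 1 \<le> D"
  have fb: "f 1 \<le> f x \<and> f x \<le> f 0" if "x \<in> {0..1}" for x
    using f(1) that unfolding monotone_on_def by auto
  have "\<bar>f x\<bar> \<le> max \<bar>f 0\<bar> \<bar>f 1\<bar>" if "x \<in> {0..1}" for x using fb[OF that] by auto
  then have u: "transfer (\<lambda>x. - f x) y = - transfer f y" if "0 \<le> y" for y
    by (rule transfer_uminus[OF that])
  have m: "mono_on {0..1} (\<lambda>x. - f x)" 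
    using f(1) by (auto simp: monotone_on_def)
  show "(mono_on {0..1} (transfer f) \<and> transfer f 1 - transfer f 0 \<le> D / 2) \<or>
    (antimono_on {0..1} (transfer f) \<and> transfer f 0 - transfer f 1 \<le> D / 2)"
    using monotone_osc_transfer_mono[OF m, of D] f(2) u by (auto simp: monotone_on_def)
qed (use monotone_osc_transfer_mono in blast)

end

section \<open>Invariance and decay of correlations\<close>

text \<open>The sum of the squares has finite expectation, hence is finite almost everywhere, and so its
  terms tend to \<open>0\<close>.\<close>

lemma AE_tendsto_zero_of_summable_second_moment:
  fixes Z :: "nat \<Rightarrow> 'a \<Rightarrow> real"
  assumes "\<And>i. integrable M (\<lambda>x. (Z i x)\<^sup>2)"
    and "summable (\<lambda>i. \<integral>x. (Z i x)\<^sup>2 \<partial>M)"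
  shows "AE x in M. (\<lambda>i. Z i x) \<longlonglongrightarrow> 0"
proof -
  have [measurable]: "(\<lambda>x. (Z i x)\<^sup>2) \<in> borel_measurable M" for i
    using assms(1) by auto
  have "(\<integral>\<^sup>+x. (\<Sum>i. ennreal ((Z i x)\<^sup>2)) \<partial>M) = (\<Sum>i. \<integral>\<^sup>+x. ennreal ((Z i x)\<^sup>2) \<partial>M)"
    using assms(1) by (intro nn_integral_suminf) auto
  also have "\<dots> = (\<Sum>i. ennreal (\<integral>x. (Z i x)\<^sup>2 \<partial>M))"
    using assms(1) by (intro suminf_cong nn_integral_eq_integral) auto
  also have "\<dots> = ennreal (\<Sum>i. \<integral>x. (Z i x)\<^sup>2 \<partial>M)"
    using assms(2) by (intro suminf_ennreal2) auto
  finally have "(\<integral>\<^sup>+x. (\<Sum>i. ennreal ((Z i x)\<^sup>2)) \<partial>M) \<noteq> \<infinity>" by simp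
  moreover have "(\<lambda>x. \<Sum>i. ennreal ((Z i x)\<^sup>2)) \<in> borel_measurable M"
    by measurable
  ultimately have "AE x in M. (\<Sum>i. ennreal ((Z i x)\<^sup>2)) \<noteq> \<infinity>"
    by (intro nn_integral_PInf_AE)
  then show ?thesis
  proof eventually_elim
    case (elim x)
    then have "summable (\<lambda>i. (Z i x)\<^sup>2)" by (intro summable_suminf_not_top) auto
    then have "(\<lambda>i. sqrt ((Z i x)\<^sup>2)) \<longlonglongrightarrow> sqrt 0"
      by (intro tendsto_real_sqrt summable_LIMSEQ_zero)
    then show ?case by (simp add: tendsto_rabs_zero_iff)
  qed
qed

context ncf begin

lemma emeasure_\<mu>_Icc:
  assumes "0 \<le> t" "t \<le> 1"
  shows "emeasure \<mu> {0..t} = ennreal (ln (1 + t / N) / ln (1 + 1 / N))"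
proof -
  define l where "l = ln (1 + 1 / real N)"
  have l: "l > 0" using ln_pos by (simp add: l_def)
  have "emeasure \<mu> {0..t} = (\<integral>\<^sup>+x. ennreal (gauss_density x) * indicator {0..t} x \<partial>lborel)"
    unfolding gauss_measure_def by (subst emeasure_density) auto
  also have "\<dots> = (\<integral>\<^sup>+x. ennreal (1 / (l * (N + x))) * indicator {0..t} x \<partial>lborel)"
    using assms by (intro nn_integral_cong) (auto simp: gauss_density_def l_def indicator_def)
  also have "\<dots> = ennreal (ln (real N + t) / l - ln (real N + 0) / l)"
  proof (rule nn_integral_FTC_Icc)
    fix x :: real assume x: "x \<in> {0..t}"
    then have p: "real N + x > 0" using N_pos by (intro add_pos_nonneg) auto
    show "((\<lambda>x. ln (N + x) / l) has_real_derivative 1 / (l * (N + x))) (at x)"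
      using p l by (auto intro!: derivative_eq_intros simp: mult.commute)
    show "0 \<le> 1 / (l * (N + x))" using p l by simp
  qed (use assms in auto)
  also have "ln (real N + t) / l - ln (real N + 0) / l = ln (1 + t / N) / l"
  proof -
    have "1 + t / N = (N + t) / N" using N_pos by (simp add: field_simps)
    moreover have "real N + t > 0" using N_pos assms by (intro add_pos_nonneg) auto
    ultimately show ?thesis using N_pos by (simp add: ln_div diff_divide_distrib)
  qed
  finally show ?thesis by (simp add: l_def)
qed

text \<open>The invariant density is positive on the unit interval, so \<open>\<mu>\<close> and Lebesgue measure have the same
  null sets there. The end points are dropped because \<open>0\<close> has no finite digit and the map sends \<open>1\<close>
  to \<open>0\<close>.\<close>

lemma AE_\<mu>_iff: "(AE x in \<mu>. P x) \<longleftrightarrow> (AE x in lborel. x \<in> {0<..<1} \<longrightarrow> P x)"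
proof -
  have "(AE x in \<mu>. P x) \<longleftrightarrow> (AE x in lborel. x \<in> {0..1} \<longrightarrow> P x)"
    unfolding gauss_measure_def
  proof (subst AE_density)
    have "0 < ennreal (gauss_density x) \<longleftrightarrow> x \<in> {0..1}" for x
      using ln_pos N_pos by (auto simp: gauss_density_def indicator_def intro!: mult_pos_pos add_pos_nonneg)
    then show "(AE x in lborel. 0 < ennreal (gauss_density x) \<longrightarrow> P x) \<longleftrightarrow> (AE x in lborel. x \<in> {0..1} \<longrightarrow> P x)"
      by (simp only:)
  qed auto
  also have "\<dots> \<longleftrightarrow> (AE x in lborel. x \<in> {0<..<1} \<longrightarrow> P x)"
  proof
    assume "AE x in lborel. x \<in> {0<..<1} \<longrightarrow> P x"
    then show "AE x in lborel. x \<in> {0..1} \<longrightarrow> P x"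
      using AE_lborel_singleton[of "0::real"] AE_lborel_singleton[of "1::real"]
      by eventually_elim auto
  qed (auto elim!: eventually_mono)
  finally show ?thesis .
qed

lemma AE_\<mu>_unit: "AE x in \<mu>. 0 < x \<and> x < 1"
  unfolding AE_\<mu>_iff by simp

sublocale prob_space \<mu>
proof
  have "AE x in \<mu>. x \<in> {0..1}" using AE_\<mu>_unit by eventually_elim auto
  then have "emeasure \<mu> UNIV = emeasure \<mu> {0..1}"
    by (intro emeasure_eq_AE) auto
  also have "\<dots> = 1" using emeasure_\<mu>_Icc[of 1] ln_pos by simp
  finally show "emeasure \<mu> (space \<mu>) = 1" by simp
qed

lemma measure_\<mu>_atMost:
  assumes "0 \<le> t" "t \<le> 1"
  shows "measure \<mu> {..t} = ln (1 + t / N) / ln (1 + 1 / N)"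
proof -
  have "AE x in \<mu>. x \<in> {..t} \<longleftrightarrow> x \<in> {0..t}" using AE_\<mu>_unit by eventually_elim auto
  then have "emeasure \<mu> {..t} = emeasure \<mu> {0..t}"
    by (intro emeasure_eq_AE) auto
  then show ?thesis
    using assms ln_pos emeasure_\<mu>_Icc[of t] by (simp add: measure_def)
qed

text \<open>A bound that is linear in \<open>t\<close> and needs no restriction to the unit interval, as required for the
  Borel-Cantelli argument.\<close>

lemma measure_\<mu>_atMost_le:
  assumes "0 \<le> t"
  shows "measure \<mu> {..t} \<le> t / (N * ln (1 + 1 / N))"
proof (cases "t \<le> 1")
  case True
  have "ln (1 + t / N) \<le> t / N" using assms by (intro ln_add_one_self_le_self) auto
  then have "ln (1 + t / N) / ln (1 + 1 / N) \<le> t / N / ln (1 + 1 / N)"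
    using ln_pos by (intro divide_right_mono) auto
  then show ?thesis using measure_\<mu>_atMost[OF assms True] by simp
next
  case False
  have "ln (1 + 1 / real N) \<le> 1 / N" by (intro ln_add_one_self_le_self) auto
  also have "\<dots> \<le> t / N" using False by (intro divide_right_mono) auto
  finally have "1 \<le> t / N / ln (1 + 1 / real N)" using ln_pos by (subst le_divide_eq) simp
  then show ?thesis using order_trans[OF prob_le_1] by simp
qed

lemma integrable_bounded:
  fixes f :: "real \<Rightarrow> real"
  assumes "f \<in> borel_measurable borel" "\<And>x. x \<in> {0..1} \<Longrightarrow> \<bar>f x\<bar> \<le> B"
  shows "integrable \<mu> f"
proof (rule integrable_const_bound)
  show "AE x in \<mu>. norm (f x) \<le> B" using AE_\<mu>_unit by eventually_elim (use assms(2) in auto)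
qed (use assms(1) in simp)

lemma orbit_in_unit: "x \<in> {0..1} \<Longrightarrow> (T ^^ n) x \<in> {0..1}"
  using T_range less_imp_le by (cases n) auto

lemma funpow_T_measurable [measurable]: "T ^^ n \<in> borel_measurable borel"
  using measurable_compose_n[OF T_measurable] .

text \<open>The duality between the transfer operator and composition with the map. Both integrands are
  nonnegative, so the identity is inherited from the one for the nonnegative integral.\<close>

lemma correlation_step:
  assumes [measurable]: "f \<in> borel_measurable borel" "g \<in> borel_measurable borel"
    and f: "\<And>x. x \<in> {0..1} \<Longrightarrow> 0 \<le> f x \<and> f x \<le> M"
    and g: "\<And>x. x \<in> {0..1} \<Longrightarrow> 0 \<le> g x"
  shows "(\<integral>x. f x * g (T x) \<partial>\<mu>) = (\<integral>y. transfer f y * g y \<partial>\<mu>)"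
proof -
  let ?F = "\<lambda>x. indicator {0..1} x * (f x * g (T x))"
  have gT: "0 \<le> g (T x)" for x using g[of "T x"] T_range[of x] by simp
  have tr: "0 \<le> transfer f y" if "y \<in> {0..1}" for y
    using transfer_range(1)[of y 0 f M] f that by auto
  have "(\<integral>\<^sup>+x. ennreal (f x * g (T x)) \<partial>\<mu>) = (\<integral>\<^sup>+x. ennreal (?F x) \<partial>\<mu>)"
    using AE_\<mu>_unit by (intro nn_integral_cong_AE, eventually_elim) (auto simp: indicator_def)
  also have "\<dots> = (\<integral>\<^sup>+y. (\<Sum>i. ennreal (weight i y * ?F (inv_branch i y))) \<partial>\<mu>)"
    by (rule nn_integral_transfer) (use f gT in \<open>auto simp: indicator_def\<close>)
  also have "\<dots> = (\<integral>\<^sup>+y. ennreal (transfer f y * g y) \<partial>\<mu>)"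
    using AE_\<mu>_unit
  proof (intro nn_integral_cong_AE, eventually_elim)
    case (elim y)
    have s: "summable (\<lambda>i. weight i y * f (inv_branch i y))"
      using elim f by (intro summable_transfer[where M=M]) auto
    have "(\<Sum>i. ennreal (weight i y * ?F (inv_branch i y))) =
      (\<Sum>i. ennreal (weight i y * f (inv_branch i y) * g y))"
      using elim inv_branch_range[of y] by (simp add: T_inv_branch mult_ac)
    also have "\<dots> = ennreal (\<Sum>i. weight i y * f (inv_branch i y) * g y)"
      using elim f g inv_branch_range[of y] weight_nonneg[of y]
      by (intro suminf_ennreal2 summable_mult2 s mult_nonneg_nonneg) auto
    also have "\<dots> = ennreal (transfer f y * g y)"
      unfolding transfer_def by (subst suminf_mult2[OF s]) simp
    finally show ?case .
  qed
  finally have e: "(\<integral>\<^sup>+x. ennreal (f x * g (T x)) \<partial>\<mu>) = (\<integral>\<^sup>+y. ennreal (transfer f y * g y) \<partial>\<mu>)" .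
  have "AE x in \<mu>. 0 \<le> f x * g (T x)"
    using AE_\<mu>_unit by eventually_elim (use f gT in auto)
  moreover have "AE y in \<mu>. 0 \<le> transfer f y * g y"
    using AE_\<mu>_unit by eventually_elim (use tr g in auto)
  ultimately show ?thesis using e by (simp add: integral_eq_nn_integral)
qed

lemma transfer_funpow:
  assumes "f \<in> borel_measurable borel" and "\<And>x. x \<in> {0..1} \<Longrightarrow> 0 \<le> f x \<and> f x \<le> M"
  shows "(transfer ^^ n) f \<in> borel_measurable borel"
    and "\<And>x. x \<in> {0..1} \<Longrightarrow> 0 \<le> (transfer ^^ n) f x \<and> (transfer ^^ n) f x \<le> M"
proof (induction n)
  case (Suc n)
  show "(transfer ^^ Suc n) f \<in> borel_measurable borel" using Suc(1) by simp
  show "0 \<le> (transfer ^^ Suc n) f x \<and> (transfer ^^ Suc n) f x \<le> M" if "x \<in> {0..1}" for x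
    using transfer_range[of x 0 "(transfer ^^ n) f" M] Suc(2) that by auto
qed (use assms in auto)

lemma correlation:
  assumes "f \<in> borel_measurable borel" and [measurable]: "g \<in> borel_measurable borel"
    and "\<And>x. x \<in> {0..1} \<Longrightarrow> 0 \<le> f x \<and> f x \<le> M"
    and g: "\<And>x. x \<in> {0..1} \<Longrightarrow> 0 \<le> g x"
  shows "(\<integral>x. f x * g ((T ^^ n) x) \<partial>\<mu>) = (\<integral>y. (transfer ^^ n) f y * g y \<partial>\<mu>)"
  using assms(1,3)
proof (induction n arbitrary: f)
  case (Suc n)
  have "(\<integral>x. f x * g ((T ^^ Suc n) x) \<partial>\<mu>) = (\<integral>x. f x * (g \<circ> (T ^^ n)) (T x) \<partial>\<mu>)"
    by (simp add: funpow_Suc_right del: funpow.simps)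
  also have "\<dots> = (\<integral>y. transfer f y * (g \<circ> (T ^^ n)) y \<partial>\<mu>)"
    using Suc.prems g orbit_in_unit by (intro correlation_step[where M=M]) auto
  also have "\<dots> = (\<integral>y. (transfer ^^ n) (transfer f) y * g y \<partial>\<mu>)"
    using Suc.IH[of "transfer f"] Suc.prems transfer_range[of _ 0 f M] by simp
  finally show ?case by (simp add: funpow_Suc_right del: funpow.simps)
qed simp

lemma distr_T: "distr \<mu> borel T = \<mu>"
proof (rule measure_eqI)
  fix A assume "A \<in> sets (distr \<mu> borel T)"
  then have [measurable]: "A \<in> sets borel" by simp
  have "emeasure (distr \<mu> borel T) A = (\<integral>\<^sup>+x. ennreal (indicator A (T x)) \<partial>\<mu>)"
    by (simp add: nn_integral_distr flip: nn_integral_indicator ennreal_indicator)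
  also have "\<dots> = (\<integral>\<^sup>+y. (\<Sum>i. ennreal (weight i y * indicator A (T (inv_branch i y)))) \<partial>\<mu>)"
    by (rule nn_integral_transfer) auto
  also have "\<dots> = (\<integral>\<^sup>+y. ennreal (indicator A y) \<partial>\<mu>)"
    using AE_\<mu>_unit
  proof (intro nn_integral_cong_AE, eventually_elim)
    case (elim y)
    have "(\<lambda>i. weight i y * indicator A y) sums (indicator A y :: real)"
      using sums_mult2[OF weight_sums_1[of y], of "indicator A y"] elim by simp
    then have "(\<Sum>i. ennreal (weight i y * indicator A y)) = ennreal (indicator A y)"
      using elim weight_nonneg[of y] by (subst suminf_ennreal2) (auto simp: sums_iff)
    then show ?case using elim by (simp add: T_inv_branch)
  qed
  finally show "emeasure (distr \<mu> borel T) A = emeasure \<mu> A" by (simp add: ennreal_indicator)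
qed simp

lemma distr_funpow_T: "distr \<mu> borel (T ^^ n) = \<mu>"
proof (induction n)
  case 0
  show ?case by (simp add: id_def distr_id2)
next
  case (Suc n)
  have "distr \<mu> borel (T ^^ Suc n) = distr (distr \<mu> borel (T ^^ n)) borel T"
    by (subst distr_distr) (auto simp: comp_def)
  then show ?case using Suc distr_T by (simp add: comp_def)
qed

lemma integral_funpow_T:
  fixes f :: "real \<Rightarrow> real"
  assumes "f \<in> borel_measurable borel"
  shows "(\<integral>x. f ((T ^^ n) x) \<partial>\<mu>) = (\<integral>x. f x \<partial>\<mu>)"
  using integral_distr[of "T ^^ n" \<mu> borel f] assms distr_funpow_T[of n] by simp

lemma monotone_osc_funpow: "monotone_osc D f \<Longrightarrow> monotone_osc (D / 2 ^ n) ((transfer ^^ n) f)"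
proof (induction n)
  case (Suc n)
  then show ?case using monotone_osc_transfer[of "D / 2 ^ n"] by (simp add: field_simps)
qed simp

text \<open>By duality the correlation is the integral of \<open>(P\<^sup>n f) \<cdot> g\<close>, and \<open>P\<^sup>n f\<close> differs from its mean, which is
  the mean of \<open>f\<close>, by at most its oscillation \<open>D / 2\<^sup>n\<close>. The error is proportional to the mean of \<open>g\<close>
  rather than to its maximum; this matters when \<open>g\<close> is a truncation at a high level.\<close>

lemma decay_of_correlations:
  assumes f [measurable]: "f \<in> borel_measurable borel" and g [measurable]: "g \<in> borel_measurable borel"
    and osc: "monotone_osc D f"
    and fM: "\<And>x. x \<in> {0..1} \<Longrightarrow> 0 \<le> f x \<and> f x \<le> M"
    and gK: "\<And>x. x \<in> {0..1} \<Longrightarrow> 0 \<le> g x \<and> g x \<le> K"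
  shows "(\<integral>x. f x * g ((T ^^ n) x) \<partial>\<mu>) \<le> (\<integral>x. f x \<partial>\<mu>) * (\<integral>x. g x \<partial>\<mu>) + D / 2 ^ n * (\<integral>x. g x \<partial>\<mu>)"
proof -
  define h where "h = (transfer ^^ n) f"
  have h [measurable]: "h \<in> borel_measurable borel" and hM: "\<And>x. x \<in> {0..1} \<Longrightarrow> 0 \<le> h x \<and> h x \<le> M"
    unfolding h_def using transfer_funpow[OF f fM] by auto
  have ih: "integrable \<mu> h" by (rule integrable_bounded[of _ M]) (use hM in auto)
  have ig: "integrable \<mu> g" by (rule integrable_bounded[of _ K]) (use gK in auto)
  have ihg: "integrable \<mu> (\<lambda>y. h y * g y)"
  proof (rule integrable_bounded[of _ "M * K"])
    show "\<bar>h x * g x\<bar> \<le> M * K" if "x \<in> {0..1}" for x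
      using hM[OF that] gK[OF that] by (auto simp: abs_mult intro!: mult_mono)
  qed auto
  have mean: "(\<integral>x. h x \<partial>\<mu>) = (\<integral>x. f x \<partial>\<mu>)"
    using correlation[OF f, of "\<lambda>_. 1" M n] fM by (simp add: h_def)
  have le: "h y \<le> (\<integral>x. f x \<partial>\<mu>) + D / 2 ^ n" if "y \<in> {0..1}" for y
  proof -
    have "h y - D / 2 ^ n \<le> (\<integral>x. h x \<partial>\<mu>)"
    proof (rule integral_ge_const[OF ih])
      show "AE x in \<mu>. h y - D / 2 ^ n \<le> h x"
        using AE_\<mu>_unit
      proof eventually_elim
        case (elim x)
        then show ?case
          using monotone_osc_diff[OF monotone_osc_funpow[OF osc, of n], of y x] that by (auto simp: h_def)
      qed
    qed
    then show ?thesis using mean by simp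
  qed
  have "(\<integral>x. f x * g ((T ^^ n) x) \<partial>\<mu>) = (\<integral>y. h y * g y \<partial>\<mu>)"
    unfolding h_def by (rule correlation[where M=M]) (use fM gK in auto)
  also have "\<dots> \<le> (\<integral>y. ((\<integral>x. f x \<partial>\<mu>) + D / 2 ^ n) * g y \<partial>\<mu>)"
  proof (rule integral_mono_AE)
    show "AE y in \<mu>. h y * g y \<le> ((\<integral>x. f x \<partial>\<mu>) + D / 2 ^ n) * g y"
      using AE_\<mu>_unit by eventually_elim (use le gK in \<open>auto intro!: mult_right_mono\<close>)
  qed (use ihg ig in auto)
  also have "\<dots> = (\<integral>x. f x \<partial>\<mu>) * (\<integral>x. g x \<partial>\<mu>) + D / 2 ^ n * (\<integral>x. g x \<partial>\<mu>)"
    using ig by (simp add: distrib_right)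
  finally show ?thesis .
qed

end

section \<open>Laws of large numbers along the orbit\<close>

lemma sum_half_powers_le: "(\<Sum>i<n. (1/2::real) ^ (n - i)) \<le> 1"
proof -
  have "(\<Sum>i<n. (1/2::real) ^ (n - i)) = 1 - (1/2) ^ n"
  proof (induction n)
    case (Suc n)
    have "(\<Sum>i<Suc n. (1/2::real) ^ (Suc n - i)) = (\<Sum>i<n. (1/2) * (1/2::real) ^ (n - i)) + 1/2"
      by (auto intro!: sum.cong simp: Suc_diff_le less_imp_le)
    then show ?case using Suc by (simp flip: sum_distrib_left sum_divide_distrib)
  qed simp
  then show ?thesis by simp
qed

text \<open>For nondecreasing \<open>S\<close>, the average at \<open>n\<close> lies between the averages at the neighbouring squares up
  to a factor \<open>((i + 1) / i)\<^sup>2\<close>, which tends to \<open>1\<close>.\<close>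

lemma tendsto_average_of_squares:
  fixes S :: "nat \<Rightarrow> real"
  assumes "mono S" and nonneg: "\<And>n. 0 \<le> S n" and lim: "(\<lambda>i. S (i\<^sup>2) / real (i\<^sup>2)) \<longlonglongrightarrow> t"
  shows "(\<lambda>n. S n / n) \<longlonglongrightarrow> t"
proof -
  define q where "q = (\<lambda>n. floor_sqrt n)"
  have q: "(q n)\<^sup>2 \<le> n" "n < (Suc (q n))\<^sup>2" for n
    unfolding q_def using Suc_floor_sqrt_power2_gt[of n] by auto
  have qinf: "filterlim q at_top sequentially"
    unfolding filterlim_at_top
  proof
    fix Z show "\<forall>\<^sub>F n in sequentially. Z \<le> q n"
      using eventually_ge_at_top[of "Z\<^sup>2"] by eventually_elim (simp add: q_def le_floor_sqrtI)
  qed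
  have r1: "(\<lambda>i. real (i\<^sup>2) / real ((Suc i)\<^sup>2)) \<longlonglongrightarrow> 1"
    by (simp only: of_nat_power of_nat_Suc) real_asymp
  have r2: "(\<lambda>i. real ((Suc i)\<^sup>2) / real (i\<^sup>2)) \<longlonglongrightarrow> 1"
    by (simp only: of_nat_power of_nat_Suc) real_asymp
  have lo: "(\<lambda>i. S (i\<^sup>2) / real (i\<^sup>2) * (real (i\<^sup>2) / real ((Suc i)\<^sup>2))) \<longlonglongrightarrow> t * 1"
    by (intro tendsto_mult lim r1)
  have hi: "(\<lambda>i. S ((Suc i)\<^sup>2) / real ((Suc i)\<^sup>2) * (real ((Suc i)\<^sup>2) / real (i\<^sup>2))) \<longlonglongrightarrow> t * 1"
    by (intro tendsto_mult r2 LIMSEQ_Suc[OF lim])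
  show ?thesis
  proof (rule real_tendsto_sandwich)
    show "(\<lambda>n. S ((q n)\<^sup>2) / real ((q n)\<^sup>2) * (real ((q n)\<^sup>2) / real ((Suc (q n))\<^sup>2))) \<longlonglongrightarrow> t"
      using filterlim_compose[OF lo qinf] by simp
    show "(\<lambda>n. S ((Suc (q n))\<^sup>2) / real ((Suc (q n))\<^sup>2) * (real ((Suc (q n))\<^sup>2) / real ((q n)\<^sup>2))) \<longlonglongrightarrow> t"
      using filterlim_compose[OF hi qinf] by simp
    show "\<forall>\<^sub>F n in sequentially. S ((q n)\<^sup>2) / real ((q n)\<^sup>2) * (real ((q n)\<^sup>2) / real ((Suc (q n))\<^sup>2)) \<le> S n / n"
      using eventually_gt_at_top[of 0]
    proof eventually_elim
      case (elim n)
      then have "q n > 0" by (simp add: q_def)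
      then have "S ((q n)\<^sup>2) / real ((q n)\<^sup>2) * (real ((q n)\<^sup>2) / real ((Suc (q n))\<^sup>2)) = S ((q n)\<^sup>2) / real ((Suc (q n))\<^sup>2)"
        by (simp del: of_nat_Suc)
      also have "\<dots> \<le> S n / n"
        using q[of n] elim monoD[OF assms(1)] nonneg by (intro frac_le) (auto simp del: of_nat_Suc of_nat_power)
      finally show ?case .
    qed
    show "\<forall>\<^sub>F n in sequentially. S n / n \<le> S ((Suc (q n))\<^sup>2) / real ((Suc (q n))\<^sup>2) * (real ((Suc (q n))\<^sup>2) / real ((q n)\<^sup>2))"
      using eventually_gt_at_top[of 0]
    proof eventually_elim
      case (elim n)
      then have q0: "q n > 0" by (simp add: q_def)
      have "S n / n \<le> S ((Suc (q n))\<^sup>2) / real ((q n)\<^sup>2)"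
        using q[of n] q0 monoD[OF assms(1)] nonneg by (intro frac_le) (auto simp del: of_nat_Suc of_nat_power)
      also have "\<dots> = S ((Suc (q n))\<^sup>2) / real ((Suc (q n))\<^sup>2) * (real ((Suc (q n))\<^sup>2) / real ((q n)\<^sup>2))"
        by (simp del: of_nat_Suc)
      finally show ?case .
    qed
  qed
qed

context ncf begin

text \<open>The variance grows linearly because the covariances along the orbit decay geometrically. The
  observable may depend on the time \<open>j\<close>, which allows truncation at a level that grows with \<open>j\<close>; the
  bound involves the maximum \<open>M\<close> and the mean \<open>C\<close> only through their product, so that \<open>M\<close> may be
  almost as large as \<open>n\<close>.\<close>

lemma
  assumes g [measurable]: "\<And>j. g j \<in> borel_measurable borel"
    and gM: "\<And>j x. j < n \<Longrightarrow> x \<in> {0..1} \<Longrightarrow> 0 \<le> g j x \<and> g j x \<le> M"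
    and osc: "\<And>j. j < n \<Longrightarrow> monotone_osc M (g j)"
    and mean: "\<And>j. j < n \<Longrightarrow> (\<integral>x. g j x \<partial>\<mu>) \<le> C"
    and "0 \<le> M"
  shows integrable_birkhoff_square:
      "integrable \<mu> (\<lambda>x. (\<Sum>j<n. g j ((T ^^ j) x) - (\<integral>x. g j x \<partial>\<mu>))\<^sup>2)" (is ?int)
    and variance_birkhoff_sum_le:
      "(\<integral>x. (\<Sum>j<n. g j ((T ^^ j) x) - (\<integral>x. g j x \<partial>\<mu>))\<^sup>2 \<partial>\<mu>) \<le> 3 * real n * M * C" (is ?var)
proof -
  define X where "X = (\<lambda>j x. g j ((T ^^ j) x) - (\<integral>x. g j x \<partial>\<mu>))"
  have [measurable]: "X j \<in> borel_measurable borel" for j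
    unfolding X_def by measurable
  have gT: "0 \<le> g j ((T ^^ j) x)" "g j ((T ^^ j) x) \<le> M" if "j < n" "x \<in> {0..1}" for j x
    using gM[OF that(1)] orbit_in_unit[OF that(2), of j] by auto
  have ig: "integrable \<mu> (g j)" if "j < n" for j
    by (rule integrable_bounded[of _ M]) (use gM[OF that] in auto)
  have igT: "integrable \<mu> (\<lambda>x. g j ((T ^^ j) x))" if "j < n" for j
    by (rule integrable_bounded[of _ M]) (use gT[OF that] in auto)
  have g0: "0 \<le> (\<integral>x. g j x \<partial>\<mu>)" if "j < n" for j
  proof (rule integral_nonneg_AE)
    show "AE x in \<mu>. 0 \<le> g j x" using AE_\<mu>_unit by eventually_elim (use gM[OF that] in auto)
  qed
  have C0: "0 \<le> C" if "n > 0" using g0[of 0] mean[of 0] that by simp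
  have iggT: "integrable \<mu> (\<lambda>x. g i ((T ^^ i) x) * g j ((T ^^ j) x))" if "i < n" "j < n" for i j
  proof (rule integrable_bounded[of _ "M * M"])
    show "\<bar>g i ((T ^^ i) x) * g j ((T ^^ j) x)\<bar> \<le> M * M" if "x \<in> {0..1}" for x
      using gT[OF \<open>i < n\<close> that] gT[OF \<open>j < n\<close> that] by (auto simp: abs_mult intro!: mult_mono)
  qed auto
  have prod: "X i x * X j x = g i ((T ^^ i) x) * g j ((T ^^ j) x) - (\<integral>x. g i x \<partial>\<mu>) * g j ((T ^^ j) x)
       - (\<integral>x. g j x \<partial>\<mu>) * g i ((T ^^ i) x) + (\<integral>x. g i x \<partial>\<mu>) * (\<integral>x. g j x \<partial>\<mu>)" for i j x
    unfolding X_def by (simp add: algebra_simps)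
  have iX: "integrable \<mu> (\<lambda>x. X i x * X j x)" if "i < n" "j < n" for i j
    unfolding prod using iggT[OF that] igT that by auto
  have cov: "(\<integral>x. X i x * X j x \<partial>\<mu>) \<le> M * C * (1/2) ^ (j - i)" if "i \<le> j" "j < n" for i j
  proof -
    have "i < n" using that by simp
    have "(\<integral>x. X i x * X j x \<partial>\<mu>) =
        (\<integral>x. g i ((T ^^ i) x) * g j ((T ^^ j) x) \<partial>\<mu>) - (\<integral>x. g i x \<partial>\<mu>) * (\<integral>x. g j x \<partial>\<mu>)"
      unfolding prod using iggT[OF \<open>i < n\<close> \<open>j < n\<close>] igT[OF \<open>i < n\<close>] igT[OF \<open>j < n\<close>]
      by (simp add: integral_funpow_T prob_space[simplified])
    also have "(\<integral>x. g i ((T ^^ i) x) * g j ((T ^^ j) x) \<partial>\<mu>) =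
        (\<integral>x. (\<lambda>y. g i y * g j ((T ^^ (j - i)) y)) ((T ^^ i) x) \<partial>\<mu>)"
      using that by (simp flip: funpow_add[unfolded comp_def, THEN fun_cong])
    also have "\<dots> = (\<integral>y. g i y * g j ((T ^^ (j - i)) y) \<partial>\<mu>)"
      by (rule integral_funpow_T) measurable
    also have "\<dots> \<le> (\<integral>x. g i x \<partial>\<mu>) * (\<integral>x. g j x \<partial>\<mu>) + M / 2 ^ (j - i) * (\<integral>x. g j x \<partial>\<mu>)"
      by (rule decay_of_correlations[OF _ _ osc gM gM]) (use that in auto)
    also have "M / 2 ^ (j - i) * (\<integral>x. g j x \<partial>\<mu>) \<le> M / 2 ^ (j - i) * C"
      using mean[OF \<open>j < n\<close>] \<open>0 \<le> M\<close> by (intro mult_left_mono) auto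
    finally show ?thesis by (simp add: power_divide)
  qed
  have "integrable \<mu> (\<lambda>x. (\<Sum>j<m. X j x)\<^sup>2) \<and> (\<integral>x. (\<Sum>j<m. X j x)\<^sup>2 \<partial>\<mu>) \<le> 3 * real m * M * C"
    if "m \<le> n" for m
    using that
  proof (induction m)
    case (Suc m)
    have eq: "(\<Sum>j<Suc m. X j x)\<^sup>2 = (\<Sum>j<m. X j x)\<^sup>2 + (2 * (\<Sum>j<m. X j x * X m x) + X m x * X m x)" for x
      by (simp add: power2_eq_square algebra_simps sum_distrib_left sum_distrib_right)
    have i1: "integrable \<mu> (\<lambda>x. (\<Sum>j<m. X j x)\<^sup>2)" using Suc by simp
    have i2: "integrable \<mu> (\<lambda>x. \<Sum>j<m. X j x * X m x)" using Suc.prems iX by auto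
    have i3: "integrable \<mu> (\<lambda>x. X m x * X m x)" using Suc.prems iX by auto
    have "(\<integral>x. (\<Sum>j<Suc m. X j x)\<^sup>2 \<partial>\<mu>) =
      (\<integral>x. (\<Sum>j<m. X j x)\<^sup>2 \<partial>\<mu>) + (2 * (\<Sum>j<m. \<integral>x. X j x * X m x \<partial>\<mu>) + (\<integral>x. X m x * X m x \<partial>\<mu>))"
      unfolding eq using i1 i2 i3 iX Suc.prems by simp
    also have "(\<Sum>j<m. \<integral>x. X j x * X m x \<partial>\<mu>) \<le> (\<Sum>j<m. M * C * (1/2) ^ (m - j))"
      using Suc.prems by (intro sum_mono cov) auto
    also have "\<dots> = M * C * (\<Sum>j<m. (1/2) ^ (m - j))" by (simp add: sum_distrib_left)
    also have "\<dots> \<le> M * C * 1"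
      using \<open>0 \<le> M\<close> C0 Suc.prems by (intro mult_left_mono sum_half_powers_le) auto
    also have "(\<integral>x. X m x * X m x \<partial>\<mu>) \<le> M * C" using cov[of m m] Suc.prems by simp
    also have "(\<integral>x. (\<Sum>j<m. X j x)\<^sup>2 \<partial>\<mu>) \<le> 3 * real m * M * C" using Suc by simp
    finally have "(\<integral>x. (\<Sum>j<Suc m. X j x)\<^sup>2 \<partial>\<mu>) \<le> 3 * real (Suc m) * M * C"
      by (simp add: algebra_simps)
    moreover have "integrable \<mu> (\<lambda>x. (\<Sum>j<Suc m. X j x)\<^sup>2)"
      unfolding eq using i1 i2 i3 by simp
    ultimately show ?case by simp
  qed simp
  from this[of n] show ?int ?var unfolding X_def by auto
qed

text \<open>The number of digits that are at least \<open>k\<close> is the Birkhoff sum of a decreasing indicator function,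
  and its variance is at most \<open>3 n\<close>. Along \<open>n = i\<^sup>2\<close> the variances of the averages are summable, and the
  sums are nondecreasing in \<open>n\<close>, so that convergence along the squares suffices.\<close>

theorem AE_frequency:
  assumes "k \<ge> N"
  shows "AE x in \<mu>. (\<lambda>n. (\<Sum>j<n. indicator {..N / k} ((T ^^ j) x)) / n)
           \<longlonglongrightarrow> ln (1 + 1 / k) / ln (1 + 1 / N)"
proof -
  let ?g = "indicator {..real N / k} :: real \<Rightarrow> real"
  define t where "t = (\<integral>x. ?g x \<partial>\<mu>)"
  have k: "k > 0" using assms N_pos by simp
  have t: "t = ln (1 + 1 / k) / ln (1 + 1 / N)"
    using measure_\<mu>_atMost[of "real N / k"] assms k N_pos by (simp add: t_def)
  define S where "S = (\<lambda>x n. \<Sum>j<n. ?g ((T ^^ j) x))"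
  define Z where "Z = (\<lambda>i x. (\<Sum>j<i\<^sup>2. ?g ((T ^^ j) x) - t) / real (i\<^sup>2))"
  have anti: "antimono_on {0..1} ?g" by (auto simp: monotone_on_def indicator_def)
  have osc: "monotone_osc 1 ?g" unfolding monotone_osc_def using anti by (auto simp: indicator_def)
  have le1: "t \<le> 1" unfolding t_def using prob_le_1 by simp
  note v = integrable_birkhoff_square[of "\<lambda>_. ?g" _ 1 1] variance_birkhoff_sum_le[of "\<lambda>_. ?g" _ 1 1]
  have int: "integrable \<mu> (\<lambda>x. (Z i x)\<^sup>2)" for i
    using v(1)[of "i\<^sup>2"] osc le1 unfolding Z_def power_divide t_def[symmetric] by (auto simp: indicator_def)
  have var: "(\<integral>x. (Z i x)\<^sup>2 \<partial>\<mu>) \<le> 3 / (real i)\<^sup>2" for i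
  proof (cases "i = 0")
    case False
    have "(\<integral>x. (Z i x)\<^sup>2 \<partial>\<mu>) = (\<integral>x. (\<Sum>j<i\<^sup>2. ?g ((T ^^ j) x) - t)\<^sup>2 \<partial>\<mu>) / (real (i\<^sup>2))\<^sup>2"
      unfolding Z_def power_divide by simp
    also have "\<dots> \<le> (3 * real (i\<^sup>2)) / (real (i\<^sup>2))\<^sup>2"
      using v(2)[of "i\<^sup>2"] osc le1 unfolding t_def[symmetric]
      by (intro divide_right_mono) (auto simp: indicator_def)
    also have "\<dots> = 3 / (real i)\<^sup>2" using False by (simp add: power2_eq_square)
    finally show ?thesis .
  qed (simp add: Z_def)
  have "summable (\<lambda>i. \<integral>x. (Z i x)\<^sup>2 \<partial>\<mu>)"
  proof (rule summable_comparison_test')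
    show "summable (\<lambda>i. 3 * inverse ((real i)\<^sup>2))"
      by (intro summable_mult inverse_power_summable) auto
    show "norm (\<integral>x. (Z i x)\<^sup>2 \<partial>\<mu>) \<le> 3 * inverse ((real i)\<^sup>2)" for i
      using var[of i] by (simp add: field_simps)
  qed
  then have "AE x in \<mu>. (\<lambda>i. Z i x) \<longlonglongrightarrow> 0"
    using int by (intro AE_tendsto_zero_of_summable_second_moment)
  then have "AE x in \<mu>. (\<lambda>n. S x n / n) \<longlonglongrightarrow> t"
  proof eventually_elim
    case (elim x)
    have "(\<lambda>i. Z i x + t) \<longlonglongrightarrow> 0 + t" by (intro tendsto_add elim tendsto_const)
    moreover have "\<forall>\<^sub>F i in sequentially. Z i x + t = S x (i\<^sup>2) / real (i\<^sup>2)"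
      using eventually_gt_at_top[of 0]
      by eventually_elim (simp add: Z_def S_def sum_subtractf diff_divide_distrib)
    ultimately have "(\<lambda>i. S x (i\<^sup>2) / real (i\<^sup>2)) \<longlonglongrightarrow> t"
      by (simp add: tendsto_cong)
    moreover have "mono (S x)" unfolding S_def by (intro monoI sum_mono2) auto
    moreover have "0 \<le> S x n" for n unfolding S_def by (intro sum_nonneg) auto
    ultimately show ?case by (intro tendsto_average_of_squares)
  qed
  then show ?thesis unfolding S_def t .
qed

end

lemma ex_power2_between:
  assumes "n > 0"
  shows "\<exists>i. n \<le> 2 ^ i \<and> 2 ^ i \<le> 2 * (n::nat)"
  using assms
proof (induction n rule: nat_induct_non_zero)
  case (Suc n)
  then obtain i where i: "n \<le> 2 ^ i" "2 ^ i \<le> 2 * n" by blast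
  show ?case
  proof (cases "n = 2 ^ i")
    case True
    then show ?thesis by (intro exI[of _ "Suc i"]) (use Suc.hyps in simp)
  next
    case False
    then show ?thesis using i by (intro exI[of _ i]) simp
  qed
qed (intro exI[of _ 0], simp)

context ncf begin

text \<open>The function \<open>(N / y)\<^sup>s\<close> majorizes the \<open>s\<close>-th power of the digit, is monotone, and has finite mean for
  \<open>s < 1\<close>, but it is unbounded. It is therefore truncated; at \<open>0\<close>, where division would give \<open>0\<close>, it
  takes the truncation level so that monotonicity extends to the closed interval.\<close>

definition trunc_power :: "real \<Rightarrow> real \<Rightarrow> real \<Rightarrow> real" where
  "trunc_power s M y = (if y \<le> 0 then M else min M ((real N / y) powr s))"

lemma trunc_power_measurable [measurable]: "trunc_power s M \<in> borel_measurable borel"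
  unfolding trunc_power_def by measurable

lemma trunc_power_range: "0 \<le> M \<Longrightarrow> 0 \<le> trunc_power s M y" "trunc_power s M y \<le> M"
  by (auto simp: trunc_power_def)

lemma trunc_power_osc:
  assumes "0 \<le> M" "0 < s"
  shows "monotone_osc M (trunc_power s M)"
proof -
  have "trunc_power s M z \<le> trunc_power s M y" if "0 \<le> y" "y \<le> z" for y z
  proof (cases "y = 0")
    case True
    then show ?thesis using trunc_power_range(2) by (simp add: trunc_power_def)
  next
    case False
    then have "real N / z \<le> real N / y" using that by (intro divide_left_mono) auto
    then have "(real N / z) powr s \<le> (real N / y) powr s"
      using assms that by (intro powr_mono2) auto
    then show ?thesis using False that by (auto simp: trunc_power_def)
  qed
  then have "antimono_on {0..1} (trunc_power s M)" by (auto simp: monotone_on_def)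
  moreover have "trunc_power s M 0 - trunc_power s M 1 \<le> M"
    using trunc_power_range(1)[OF assms(1), of s 1] trunc_power_range(2)[of s M 0] by linarith
  ultimately show ?thesis by (simp add: monotone_osc_def)
qed

lemma trunc_power_mean_bounded:
  assumes "0 < s" "s < 1"
  shows "\<exists>C\<ge>0. \<forall>M\<ge>0. (\<integral>x. trunc_power s M x \<partial>\<mu>) \<le> C"
proof -
  define K where "K = real N powr s / (N * ln (1 + 1 / N))"
  define C where "C = K * (1 / (1 - s))"
  have K0: "0 \<le> K" unfolding K_def using ln_pos by (auto intro!: divide_nonneg_pos mult_pos_pos simp: N_pos)
  have C0: "0 \<le> C" unfolding C_def using K0 assms by simp
  have "(\<integral>x. trunc_power s M x \<partial>\<mu>) \<le> C" if M: "M \<ge> 0" for M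
  proof -
    let ?b = "\<lambda>x::real. if x \<in> {0..1} then K * x powr (- s) else 0"
    have "(\<integral>\<^sup>+x. ennreal (trunc_power s M x) \<partial>\<mu>) =
        (\<integral>\<^sup>+x. ennreal (gauss_density x * trunc_power s M x) \<partial>lborel)"
      unfolding gauss_measure_def
      by (subst nn_integral_density) (auto simp: ennreal_mult' gauss_density_nonneg)
    also have "\<dots> \<le> (\<integral>\<^sup>+x. ennreal (?b x) \<partial>lborel)"
    proof (rule nn_integral_mono_AE)
      show "AE x in lborel. ennreal (gauss_density x * trunc_power s M x) \<le> ennreal (?b x)"
        using AE_lborel_singleton[of "0::real"]
      proof eventually_elim
        case (elim x)
        show ?case
        proof (cases "x \<in> {0..1}")
          case True
          then have x: "0 < x" "x \<le> 1" using elim by auto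
          have "gauss_density x \<le> 1 / (N * ln (1 + 1 / N))"
            using x ln_pos N_pos unfolding gauss_density_def
            by (simp add: mult.commute del: divide_const_simps) (intro divide_left_mono mult_mono mult_pos_pos, auto)
          moreover have "trunc_power s M x \<le> (real N / x) powr s"
            using x by (simp add: trunc_power_def)
          ultimately have "gauss_density x * trunc_power s M x \<le> 1 / (N * ln (1 + 1 / N)) * (real N / x) powr s"
            using M trunc_power_range(1)[OF M] ln_pos by (intro mult_mono) auto
          also have "\<dots> = K * x powr (- s)"
            using x by (simp add: K_def powr_divide powr_minus divide_simps)
          finally show ?thesis using True by (simp add: ennreal_leI)
        qed (simp add: gauss_density_def)
      qed
    qed
    also have "\<dots> = ennreal C"
    proof (rule nn_integral_has_integral_lborel)
      have "((\<lambda>x. K * x powr (- s)) has_integral (K * (1 powr (- s + 1) / (- s + 1)))) {0..1}"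
        using assms by (intro has_integral_mult_right has_integral_powr_from_0) auto
      then show "(?b has_integral C) UNIV"
        unfolding has_integral_restrict_UNIV C_def by simp
    qed (use K0 in auto)
    finally have le: "(\<integral>\<^sup>+x. ennreal (trunc_power s M x) \<partial>\<mu>) \<le> ennreal C" .
    have "integrable \<mu> (trunc_power s M)"
      using trunc_power_range(1)[OF M, of s] trunc_power_range(2)[of s M] by (intro integrable_bounded[of _ M]) auto
    then have "ennreal (\<integral>x. trunc_power s M x \<partial>\<mu>) \<le> ennreal C"
      using le trunc_power_range(1)[OF M] by (subst nn_integral_eq_integral[symmetric]) auto
    then show ?thesis using C0 by (simp add: ennreal_le_iff)
  qed
  then show ?thesis using C0 by blast
qed

text \<open>Truncate at time \<open>j\<close> at the level \<open>(j + 1)\<^sup>\<theta>\<close> for some \<open>\<theta>\<close> with \<open>s < \<theta> < 1\<close>. As \<open>\<theta> > s\<close>, the probability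
  that the truncation is effective at time \<open>j\<close> is of the summable order \<open>j\<close> to the power \<open>- \<theta> / s\<close>, so
  by Borel-Cantelli it matters only finitely often. As \<open>\<theta> < 1\<close>, the variance of the average of the
  first \<open>n\<close> truncated terms is of order \<open>n\<close> to the power \<open>\<theta> - 1\<close>, which is summable along \<open>n = 2\<^sup>i\<close>.
  Doubling the length costs only a factor \<open>2\<close>, which is harmless for a mere bound.\<close>

theorem AE_power_sums_bounded:
  assumes s: "0 < s" "s < 1"
  shows "AE x in \<mu>. \<exists>B. \<forall>n. (\<Sum>j<n. (real N / (T ^^ j) x) powr s) \<le> B * real n"
proof -
  define \<theta> where "\<theta> = (s + 1) / 2"
  have \<theta>: "s < \<theta>" "\<theta> < 1" "0 < \<theta>" using s by (auto simp: \<theta>_def)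
  define g where "g = (\<lambda>j::nat. trunc_power s (real (Suc j) powr \<theta>))"
  obtain C where C: "C \<ge> 0" "\<And>M. M \<ge> 0 \<Longrightarrow> (\<integral>x. trunc_power s M x \<partial>\<mu>) \<le> C"
    using trunc_power_mean_bounded[OF s] by blast
  have gC: "(\<integral>x. g j x \<partial>\<mu>) \<le> C" for j unfolding g_def by (rule C) simp
  have gm [measurable]: "g j \<in> borel_measurable borel" for j unfolding g_def by measurable

  define Z where "Z = (\<lambda>i x. (\<Sum>j<2 ^ i. g j ((T ^^ j) x) - (\<integral>x. g j x \<partial>\<mu>)) / 2 ^ i)"
  define M where "M = (\<lambda>i::nat. (2 ^ i :: real) powr \<theta>)"
  have M0: "M i \<ge> 0" for i by (simp add: M_def)
  have gM: "g j x \<le> M i" "monotone_osc (M i) (g j)" "g j x \<ge> 0" if "j < 2 ^ i" for i j x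
  proof -
    have "Suc j \<le> 2 ^ i" using that by simp
    then have "real (Suc j) \<le> 2 ^ i" by (metis of_nat_le_iff of_nat_numeral of_nat_power)
    then have le: "real (Suc j) powr \<theta> \<le> M i" unfolding M_def using \<theta> by (intro powr_mono2) auto
    show "g j x \<le> M i" unfolding g_def using trunc_power_range(2) le by (rule order_trans)
    show "g j x \<ge> 0" unfolding g_def by (rule trunc_power_range) simp
    show "monotone_osc (M i) (g j)"
      using trunc_power_osc[of "real (Suc j) powr \<theta>" s] s le by (auto simp: g_def monotone_osc_def)
  qed
  have bnd: "0 \<le> g j x \<and> g j x \<le> M i" if "j < 2 ^ i" "x \<in> {0..1}" for i j x
    using gM that by simp
  have sq: "integrable \<mu> (\<lambda>x. (\<Sum>j<2 ^ i. g j ((T ^^ j) x) - (\<integral>x. g j x \<partial>\<mu>))\<^sup>2)" for i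
    by (rule integrable_birkhoff_square[where M="M i" and C=C]) (rule gm bnd gM(2) gC M0 | assumption)+
  have sq_le: "(\<integral>x. (\<Sum>j<2 ^ i. g j ((T ^^ j) x) - (\<integral>x. g j x \<partial>\<mu>))\<^sup>2 \<partial>\<mu>) \<le> 3 * real (2 ^ i) * M i * C" for i
    by (rule variance_birkhoff_sum_le) (rule gm bnd gM(2) gC M0 | assumption)+
  have int: "integrable \<mu> (\<lambda>x. (Z i x)\<^sup>2)" for i
    unfolding Z_def power_divide by (rule integrable_divide[OF sq])
  have var: "(\<integral>x. (Z i x)\<^sup>2 \<partial>\<mu>) \<le> 3 * C * (2 powr (\<theta> - 1)) ^ i" for i
  proof -
    have "(\<integral>x. (Z i x)\<^sup>2 \<partial>\<mu>) = (\<integral>x. (\<Sum>j<2 ^ i. g j ((T ^^ j) x) - (\<integral>x. g j x \<partial>\<mu>))\<^sup>2 \<partial>\<mu>) / (2 ^ i)\<^sup>2"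
      unfolding Z_def power_divide by (rule integral_divide_zero)
    also have "\<dots> \<le> (3 * real (2 ^ i) * M i * C) / (2 ^ i)\<^sup>2"
      by (intro divide_right_mono sq_le) simp
    also have "\<dots> = 3 * C * (M i / 2 ^ i)" by (simp add: power2_eq_square)
    also have "M i / 2 ^ i = (2 powr (\<theta> - 1)) ^ i"
    proof -
      have "M i / 2 ^ i = (2 ^ i) powr (\<theta> - 1)" by (simp add: M_def powr_diff)
      also have "\<dots> = (2 powr real i) powr (\<theta> - 1)" by (simp add: powr_realpow)
      also have "\<dots> = 2 powr (real i * (\<theta> - 1))" by (rule powr_powr)
      also have "\<dots> = (2 powr (\<theta> - 1)) ^ i" by (rule powr_power[symmetric]) simp
      finally show ?thesis .
    qed
    finally show ?thesis .
  qed
  have "summable (\<lambda>i. \<integral>x. (Z i x)\<^sup>2 \<partial>\<mu>)"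
  proof (rule summable_comparison_test')
    have "(2::real) powr (\<theta> - 1) < 2 powr 0" using \<theta> by (intro powr_less_mono) auto
    then show "summable (\<lambda>i. 3 * C * (2 powr (\<theta> - 1)) ^ i)"
      by (intro summable_mult summable_geometric) simp
    show "norm (\<integral>x. (Z i x)\<^sup>2 \<partial>\<mu>) \<le> 3 * C * (2 powr (\<theta> - 1)) ^ i" for i
      using var[of i] by simp
  qed
  then have Z0: "AE x in \<mu>. (\<lambda>i. Z i x) \<longlonglongrightarrow> 0"
    using int by (intro AE_tendsto_zero_of_summable_second_moment)

  \<comment> \<open>\<open>A j\<close> is the event that the truncation is effective at time \<open>j\<close>.\<close>
  define A where "A = (\<lambda>j::nat. {x. (T ^^ j) x \<le> N * real (Suc j) powr (- (\<theta> / s))})"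
  have Am [measurable]: "A j \<in> sets borel" for j
    unfolding A_def by measurable
  have "measure \<mu> (A j) \<le> real (Suc j) powr (- (\<theta> / s)) / ln (1 + 1 / N)" for j
  proof -
    let ?t = "N * real (Suc j) powr (- (\<theta> / s))"
    have "measure \<mu> (A j) = (\<integral>x. indicator (A j) x \<partial>\<mu>)" by simp
    also have "\<dots> = (\<integral>x. indicator {..?t} ((T ^^ j) x) \<partial>\<mu>)"
      by (intro Bochner_Integration.integral_cong) (auto simp: A_def indicator_def)
    also have "\<dots> = measure \<mu> {..?t}" by (subst integral_funpow_T) auto
    also have "\<dots> \<le> ?t / (N * ln (1 + 1 / N))" by (intro measure_\<mu>_atMost_le) simp
    finally show ?thesis using N_pos by simp
  qed
  note Ale = this
  have "AE x in \<mu>. \<forall>\<^sub>F j in sequentially. x \<in> space \<mu> - A j"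
  proof (rule borel_cantelli_AE1)
    show "summable (\<lambda>j. measure \<mu> (A j))"
    proof (rule summable_comparison_test')
      have "- (\<theta> / s) < -1" using s \<theta> by (simp add: field_simps)
      then have "summable (\<lambda>j. real j powr (- (\<theta> / s)))" by (subst summable_real_powr_iff)
      then have "summable (\<lambda>j. real (Suc j) powr (- (\<theta> / s)))" by (subst summable_Suc_iff)
      then show "summable (\<lambda>j. real (Suc j) powr (- (\<theta> / s)) / ln (1 + 1 / N))" by (rule summable_divide)
      show "norm (measure \<mu> (A j)) \<le> real (Suc j) powr (- (\<theta> / s)) / ln (1 + 1 / N)" for j
        using Ale[of j] by simp
    qed
  qed (auto simp: emeasure_eq_measure)
  then show ?thesis
    using Z0
  proof eventually_elim
    case (elim x)
    let ?y = "\<lambda>j. (real N / (T ^^ j) x) powr s"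
    obtain J where J: "\<And>j. j \<ge> J \<Longrightarrow> x \<notin> A j"
      using elim(1) by (auto simp: eventually_sequentially)
    have yg: "?y j \<le> g j ((T ^^ j) x)" if "j \<ge> J" for j
    proof -
      let ?p = "real (Suc j) powr (\<theta> / s)"
      have lt: "N / ?p < (T ^^ j) x"
        using J[OF that] by (simp add: A_def powr_minus divide_inverse)
      moreover have "0 \<le> N / ?p" by simp
      ultimately have pos: "0 < (T ^^ j) x" by linarith
      have "real N / (T ^^ j) x \<le> ?p"
        using lt pos by (simp add: field_simps)
      then have "?y j \<le> ?p powr s" using s pos by (intro powr_mono2) auto
      also have "\<dots> = real (Suc j) powr \<theta>" using s by (simp add: powr_powr)
      finally show ?thesis using pos by (simp add: g_def trunc_power_def)
    qed
    define D where "D = (\<Sum>j<J. ?y j)"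
    have D0: "0 \<le> D" unfolding D_def by (intro sum_nonneg) simp
    have g0: "0 \<le> g j y" for j y unfolding g_def by (rule trunc_power_range) simp
    have yS: "(\<Sum>j<n. ?y j) \<le> D + (\<Sum>j<n. g j ((T ^^ j) x))" for n
    proof -
      have "(\<Sum>j<n. ?y j) \<le> (\<Sum>j<n. (if j < J then ?y j else 0) + g j ((T ^^ j) x))"
        using yg g0 by (intro sum_mono) (auto simp: not_less)
      also have "\<dots> = (\<Sum>j\<in>{..<n} \<inter> {..<J}. ?y j) + (\<Sum>j<n. g j ((T ^^ j) x))"
        by (simp add: sum.distrib sum.inter_restrict)
      also have "(\<Sum>j\<in>{..<n} \<inter> {..<J}. ?y j) \<le> D"
        unfolding D_def by (intro sum_mono2) auto
      finally show ?thesis by simp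
    qed
    obtain B' where B': "\<And>i. \<bar>Z i x\<bar> \<le> B'"
      using convergent_imp_Bseq[of "\<lambda>i. Z i x"] elim(2) by (auto simp: convergent_def Bseq_def)
    have dy: "(\<Sum>j<2 ^ i. g j ((T ^^ j) x)) \<le> (B' + C) * 2 ^ i" for i
    proof -
      have "(\<Sum>j<2 ^ i. g j ((T ^^ j) x)) = Z i x * 2 ^ i + (\<Sum>j<2 ^ i. (\<integral>x. g j x \<partial>\<mu>))"
        by (simp add: Z_def sum_subtractf)
      also have "Z i x * 2 ^ i \<le> B' * 2 ^ i" using B'[of i] by (intro mult_right_mono) auto
      also have "(\<Sum>j<2 ^ i. (\<integral>x. g j x \<partial>\<mu>)) \<le> (\<Sum>j<(2::nat) ^ i. C)"
        by (intro sum_mono gC)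
      finally show ?thesis by (simp add: algebra_simps)
    qed
    have BC: "0 \<le> B' + C" using B'[of 0] C by simp
    show ?case
    proof (intro exI[of _ "D + 2 * (B' + C)"] allI)
      fix n :: nat
      show "(\<Sum>j<n. ?y j) \<le> (D + 2 * (B' + C)) * n"
      proof (cases "n = 0")
        case False
        then obtain i where i: "n \<le> 2 ^ i" "2 ^ i \<le> 2 * n" using ex_power2_between[of n] by auto
        have "(\<Sum>j<n. g j ((T ^^ j) x)) \<le> (\<Sum>j<2 ^ i. g j ((T ^^ j) x))"
          using i g0 by (intro sum_mono2) auto
        also have "\<dots> \<le> (B' + C) * 2 ^ i" by (rule dy)
        also have "\<dots> \<le> (B' + C) * (2 * n)"
        proof (rule mult_left_mono)
          show "(2::real) ^ i \<le> 2 * n" using i(2) by (metis of_nat_le_iff of_nat_mult of_nat_numeral of_nat_power)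
        qed (rule BC)
        finally have "(\<Sum>j<n. ?y j) \<le> D + (B' + C) * (2 * n)" using yS[of n] by linarith
        also have "D \<le> D * n" using D0 False by (simp add: mult_left_le mult_le_cancel_left1)
        finally show ?thesis by (simp add: algebra_simps)
      qed simp
    qed
  qed
qed

end

section \<open>Averages of functions of a digit sequence\<close>

lemma sum_by_value:
  fixes \<psi> :: "nat \<Rightarrow> real" and d :: "nat \<Rightarrow> nat"
  shows "(\<Sum>k<K. \<psi> k * (\<Sum>j<n. of_bool (d j = k))) = (\<Sum>j<n. of_bool (d j < K) * \<psi> (d j))"
proof -
  have "(\<Sum>k<K. \<psi> k * (\<Sum>j<n. of_bool (d j = k))) = (\<Sum>j<n. \<Sum>k<K. \<psi> k * of_bool (d j = k))"
    unfolding sum_distrib_left by (rule sum.swap)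
  also have "\<dots> = (\<Sum>j<n. of_bool (d j < K) * \<psi> (d j))"
    by (intro sum.cong refl) (simp add: of_bool_def if_distrib[of "\<lambda>x. _ * x"] cong: if_cong)
  finally show ?thesis .
qed

text \<open>The averages over the digits below \<open>K\<close> converge because they involve finitely many frequencies.
  Digits \<open>k \<ge> K\<close> satisfy \<open>k\<^sup>r \<le> K\<^sup>r\<^sup>-\<^sup>s k\<^sup>s\<close>, so their contribution is at most a constant times \<open>K\<^sup>r\<^sup>-\<^sup>s\<close>,
  uniformly in \<open>n\<close>. The sequence of digits is arbitrary here; no probability is involved.\<close>

lemma averages_of_digit_function:
  fixes d :: "nat \<Rightarrow> nat" and p \<phi> :: "nat \<Rightarrow> real"
  assumes freq: "\<And>k. (\<lambda>n. (\<Sum>j<n. of_bool (d j = k)) / n) \<longlonglongrightarrow> p k"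
    and bound: "\<And>n. (\<Sum>j<n. real (d j) powr s) \<le> B * real n"
    and \<phi>: "\<And>k. \<bar>\<phi> k\<bar> \<le> C * real k powr r" and "r < s"
  shows "summable (\<lambda>k. p k * \<phi> k)" and "(\<lambda>n. (\<Sum>j<n. \<phi> (d j)) / n) \<longlonglongrightarrow> (\<Sum>k. p k * \<phi> k)"
proof -
  have lim: "(\<lambda>n. (\<Sum>j<n. of_bool (d j < K) * \<psi> (d j)) / n) \<longlonglongrightarrow> (\<Sum>k<K. p k * \<psi> k)" for K and \<psi> :: "nat \<Rightarrow> real"
  proof -
    have "(\<lambda>n. \<Sum>k<K. \<psi> k * ((\<Sum>j<n. of_bool (d j = k)) / n)) \<longlonglongrightarrow> (\<Sum>k<K. \<psi> k * p k)"
      by (intro tendsto_sum tendsto_mult freq tendsto_const)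
    then show ?thesis
      by (simp only: times_divide_eq_right sum_divide_distrib[symmetric] sum_by_value mult.commute[of "\<psi> _" "p _"])
  qed
  have p0: "p k \<ge> 0" for k
    by (rule LIMSEQ_le_const[OF freq]) (auto intro!: exI[of _ 0] divide_nonneg_nonneg sum_nonneg)
  have B0: "B \<ge> 0" using bound[of 1] by (simp add: order_trans[OF powr_ge_zero])
  have C0: "C \<ge> 0" using order_trans[OF abs_ge_zero \<phi>[of 1]] by simp
  have ps: "summable (\<lambda>k. p k * real k powr s)"
  proof (rule summableI_nonneg_bounded)
    show "(\<Sum>k<K. p k * real k powr s) \<le> B" for K
    proof (rule LIMSEQ_le_const2[OF lim])
      have "(\<Sum>j<n. of_bool (d j < K) * real (d j) powr s) / n \<le> B" if "n \<ge> 1" for n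
      proof -
        have "(\<Sum>j<n. of_bool (d j < K) * real (d j) powr s) \<le> (\<Sum>j<n. real (d j) powr s)"
          by (intro sum_mono) auto
        also have "\<dots> \<le> B * real n" by (rule bound)
        finally show ?thesis using that by (simp add: divide_le_eq)
      qed
      then show "\<exists>M. \<forall>n\<ge>M. (\<Sum>j<n. of_bool (d j < K) * real (d j) powr s) / n \<le> B" by blast
    qed
  qed (use p0 in auto)
  show sm: "summable (\<lambda>k. p k * \<phi> k)"
  proof (rule summable_comparison_test')
    show "summable (\<lambda>k. C * (p k * real k powr s))" by (intro summable_mult ps)
    show "norm (p k * \<phi> k) \<le> C * (p k * real k powr s)" if "k \<ge> 0" for k
    proof -
      have "real k powr r \<le> real k powr s" using \<open>r < s\<close> by (cases "k = 0") (auto intro!: powr_mono)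
      then have "\<bar>\<phi> k\<bar> \<le> C * real k powr s"
        using \<phi>[of k] C0 by (meson mult_left_mono order_trans)
      then have "p k * \<bar>\<phi> k\<bar> \<le> p k * (C * real k powr s)" by (intro mult_left_mono p0)
      then show ?thesis using p0[of k] by (simp add: abs_mult mult.left_commute)
    qed
  qed
  have tail: "\<bar>(\<Sum>j<n. \<phi> (d j)) / n - (\<Sum>j<n. of_bool (d j < K) * \<phi> (d j)) / n\<bar> \<le> C * B * real K powr (r - s)"
    if K: "K > 0" for n K
  proof (cases "n = 0")
    case False
    have "(\<Sum>j<n. \<phi> (d j)) - (\<Sum>j<n. of_bool (d j < K) * \<phi> (d j)) = (\<Sum>j<n. of_bool (K \<le> d j) * \<phi> (d j))"
      unfolding sum_subtractf[symmetric] by (intro sum.cong) auto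
    also have "\<bar>\<dots>\<bar> \<le> (\<Sum>j<n. \<bar>of_bool (K \<le> d j) * \<phi> (d j)\<bar>)" by (rule sum_abs)
    also have "\<dots> \<le> (\<Sum>j<n. C * real K powr (r - s) * real (d j) powr s)"
    proof (intro sum_mono)
      fix j
      show "\<bar>of_bool (K \<le> d j) * \<phi> (d j)\<bar> \<le> C * real K powr (r - s) * real (d j) powr s"
      proof (cases "K \<le> d j")
        case True
        have "real (d j) powr (r - s) \<le> real K powr (r - s)"
          using True K \<open>r < s\<close> by (intro powr_mono2') auto
        moreover have "real (d j) powr r = real (d j) powr (r - s) * real (d j) powr s"
          by (simp flip: powr_add)
        ultimately have "real (d j) powr r \<le> real K powr (r - s) * real (d j) powr s"
          by (simp add: mult_right_mono)
        then have "C * real (d j) powr r \<le> C * (real K powr (r - s) * real (d j) powr s)"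
          using C0 by (rule mult_left_mono)
        then show ?thesis using True \<phi>[of "d j"] by (simp add: mult.assoc)
      qed (use C0 in simp)
    qed
    also have "\<dots> = C * real K powr (r - s) * (\<Sum>j<n. real (d j) powr s)" by (simp add: sum_distrib_left)
    also have "\<dots> \<le> C * real K powr (r - s) * (B * real n)"
      using C0 by (intro mult_left_mono bound) auto
    finally show ?thesis using False by (simp add: divide_le_eq mult_ac flip: diff_divide_distrib)
  qed (use B0 C0 in simp)
  let ?L = "\<Sum>k. p k * \<phi> k"
  have small: "(\<lambda>K. C * B * real K powr (r - s)) \<longlonglongrightarrow> 0"
    using tendsto_mult_right_zero[OF tendsto_neg_powr[OF _ filterlim_real_sequentially, of "r - s"]] \<open>r < s\<close> by simp
  show "(\<lambda>n. (\<Sum>j<n. \<phi> (d j)) / n) \<longlonglongrightarrow> ?L"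
  proof (rule LIMSEQ_I)
    fix \<epsilon> :: real assume "\<epsilon> > 0"
    then have e: "\<epsilon> / 3 > 0" by simp
    have "\<forall>\<^sub>F K in sequentially. K > 0 \<and> C * B * real K powr (r - s) < \<epsilon> / 3 \<and> \<bar>(\<Sum>k<K. p k * \<phi> k) - ?L\<bar> < \<epsilon> / 3"
      using eventually_gt_at_top[of 0] order_tendstoD(2)[OF small e] tendstoD[OF summable_LIMSEQ[OF sm] e]
      by eventually_elim (simp add: dist_real_def)
    then obtain K where K: "K > 0" "C * B * real K powr (r - s) < \<epsilon> / 3" "\<bar>(\<Sum>k<K. p k * \<phi> k) - ?L\<bar> < \<epsilon> / 3"
      by (auto simp: eventually_sequentially)
    obtain n0 where n0: "\<And>n. n \<ge> n0 \<Longrightarrow> \<bar>(\<Sum>j<n. of_bool (d j < K) * \<phi> (d j)) / n - (\<Sum>k<K. p k * \<phi> k)\<bar> < \<epsilon> / 3"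
      using LIMSEQ_D[OF lim e, of K \<phi>] by auto
    have "norm ((\<Sum>j<n. \<phi> (d j)) / n - ?L) < \<epsilon>" if "n \<ge> n0" for n
      using n0[OF that] K tail[OF K(1), of n] unfolding real_norm_def by linarith
    then show "\<exists>n0. \<forall>n\<ge>n0. norm ((\<Sum>j<n. \<phi> (d j)) / n - ?L) < \<epsilon>" by blast
  qed
qed

text \<open>Writing a digit as the number of positive integers that do not exceed it, its average is at
  least any finite sum of tail frequencies, and the sum of the tail frequencies diverges.\<close>

lemma averages_of_powers_at_top:
  fixes d :: "nat \<Rightarrow> nat" and t :: "nat \<Rightarrow> real"
  assumes freq: "\<And>k. k \<ge> N \<Longrightarrow> (\<lambda>n. (\<Sum>j<n. of_bool (k \<le> d j)) / n) \<longlonglongrightarrow> t k"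
    and div: "filterlim (\<lambda>K. \<Sum>i<K. t (N + i)) at_top sequentially"
    and "N > 0" and "r \<ge> 1"
  shows "filterlim (\<lambda>n. (\<Sum>j<n. real (d j) powr r) / n) at_top sequentially"
  unfolding filterlim_at_top
proof
  fix Z :: real
  have "\<forall>\<^sub>F K in sequentially. Z + 1 \<le> (\<Sum>i<K. t (N + i))"
    using div unfolding filterlim_at_top by blast
  then obtain K where K: "Z + 1 \<le> (\<Sum>i<K. t (N + i))" by (auto simp: eventually_sequentially)
  have "(\<lambda>n. \<Sum>i<K. (\<Sum>j<n. of_bool (N + i \<le> d j)) / real n) \<longlonglongrightarrow> (\<Sum>i<K. t (N + i))"
    by (intro tendsto_sum freq) simp
  then have "\<forall>\<^sub>F n in sequentially. Z < (\<Sum>i<K. (\<Sum>j<n. of_bool (N + i \<le> d j)) / real n)"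
    using K by (intro order_tendstoD(1)) auto
  then show "\<forall>\<^sub>F n in sequentially. Z \<le> (\<Sum>j<n. real (d j) powr r) / n"
  proof eventually_elim
    case (elim n)
    have "(\<Sum>i<K. (\<Sum>j<n. of_bool (N + i \<le> d j)) / real n) = (\<Sum>j<n. \<Sum>i<K. of_bool (N + i \<le> d j)) / n"
      unfolding sum_divide_distrib by (rule sum.swap)
    also have "\<dots> \<le> (\<Sum>j<n. real (d j) powr r) / n"
    proof (intro divide_right_mono sum_mono)
      fix j
      have "(\<Sum>i<K. of_bool (N + i \<le> d j) :: real) = real (card {i\<in>{..<K}. N + i \<le> d j})"
        by (simp add: of_bool_def sum.If_cases Int_def)
      also have "\<dots> \<le> real (card {..<d j})"
        using \<open>N > 0\<close> by (intro of_nat_mono card_mono) auto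
      also have "\<dots> \<le> real (d j) powr r"
        using \<open>r \<ge> 1\<close> powr_mono[of 1 r "real (d j)"] by (cases "d j = 0") auto
      finally show "(\<Sum>i<K. of_bool (N + i \<le> d j)) \<le> real (d j) powr r" .
    qed simp
    finally show ?case using elim by simp
  qed
qed

section \<open>Asymptotics of the constants\<close>

text \<open>A version of the Stolz-Cesaro theorem for tails of series. With a telescoping \<open>b\<close> it turns the
  asymptotics of a single term into the asymptotics of the tail.\<close>

lemma tail_sum_ratio:
  fixes a b :: "nat \<Rightarrow> real"
  assumes b: "\<And>k. k > 0 \<Longrightarrow> b k > 0" "summable b" and lim: "(\<lambda>k. a k / b k) \<longlonglongrightarrow> L"
  shows "summable a" and "(\<lambda>N. (\<Sum>i. a (N + i)) / (\<Sum>i. b (N + i))) \<longlonglongrightarrow> L"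
proof -
  have close: "\<forall>\<^sub>F k in sequentially. \<bar>a k - L * b k\<bar> \<le> \<epsilon> * b k" if "\<epsilon> > 0" for \<epsilon>
    using tendstoD[OF lim that] eventually_gt_at_top[of 0]
  proof eventually_elim
    case (elim k)
    then have "\<bar>a k / b k - L\<bar> * b k \<le> \<epsilon> * b k"
      using b(1)[of k] by (intro mult_right_mono) (auto simp: dist_real_def)
    moreover have "\<bar>a k / b k - L\<bar> * b k = \<bar>(a k / b k - L) * b k\<bar>" using b(1)[of k] elim by (simp add: abs_mult)
    moreover have "(a k / b k - L) * b k = a k - L * b k" using b(1)[of k] elim by (simp add: field_simps)
    ultimately show ?case by simp
  qed
  show sa: "summable a"
  proof (rule summable_comparison_test_ev)
    show "summable (\<lambda>k. (\<bar>L\<bar> + 1) * b k)" by (intro summable_mult b)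
    show "\<forall>\<^sub>F k in sequentially. norm (a k) \<le> (\<bar>L\<bar> + 1) * b k"
      using close[OF zero_less_one] eventually_gt_at_top[of 0]
    proof eventually_elim
      case (elim k)
      have "\<bar>a k\<bar> \<le> \<bar>a k - L * b k\<bar> + \<bar>L * b k\<bar>" by linarith
      also have "\<bar>L * b k\<bar> = \<bar>L\<bar> * b k" using b(1)[of k] elim by (simp add: abs_mult)
      finally show ?case using elim by (simp add: algebra_simps)
    qed
  qed
  have sh: "summable (\<lambda>i. f (N + i))" if "summable f" for f :: "nat \<Rightarrow> real" and N
    using summable_ignore_initial_segment[OF that, of N] by (simp add: add.commute)
  show "(\<lambda>N. (\<Sum>i. a (N + i)) / (\<Sum>i. b (N + i))) \<longlonglongrightarrow> L"
  proof (rule LIMSEQ_I)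
    fix \<epsilon> :: real assume "\<epsilon> > 0"
    then obtain K where K: "\<And>k. k \<ge> K \<Longrightarrow> \<bar>a k - L * b k\<bar> \<le> \<epsilon> / 2 * b k"
      using close[of "\<epsilon> / 2"] by (auto simp: eventually_sequentially)
    have "norm ((\<Sum>i. a (N + i)) / (\<Sum>i. b (N + i)) - L) < \<epsilon>" if "N \<ge> Suc K" for N
    proof -
      define Bs where "Bs = (\<Sum>i. b (N + i))"
      have Bs: "Bs > 0" unfolding Bs_def using that b by (intro suminf_pos sh) auto
      have "(\<Sum>i. a (N + i)) - L * Bs = (\<Sum>i. a (N + i) - L * b (N + i))"
        unfolding Bs_def using sh[OF sa] sh[OF b(2)]
        by (simp add: suminf_mult suminf_diff[symmetric] summable_mult)
      also have "\<bar>\<dots>\<bar> \<le> (\<Sum>i. \<epsilon> / 2 * b (N + i))"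
      proof -
        have "summable (\<lambda>i. \<epsilon> / 2 * b (N + i))" by (intro summable_mult sh b)
        then show ?thesis using K that by (subst real_norm_def[symmetric], intro norm_suminf_le) auto
      qed
      also have "\<dots> = \<epsilon> / 2 * Bs" unfolding Bs_def by (intro suminf_mult sh b)
      also have "\<dots> < \<epsilon> * Bs" using Bs \<open>\<epsilon> > 0\<close> by simp
      finally have "\<bar>((\<Sum>i. a (N + i)) - L * Bs) / Bs\<bar> < \<epsilon>" using Bs by (simp add: divide_less_eq)
      then show ?thesis using Bs by (simp add: Bs_def[symmetric] diff_divide_distrib)
    qed
    then show "\<exists>K. \<forall>N\<ge>K. norm ((\<Sum>i. a (N + i)) / (\<Sum>i. b (N + i)) - L) < \<epsilon>" by blast
  qed
qed

text \<open>Up to the common factor \<open>ln (1 + 1/N)\<close>, \<open>log_weight k\<close> is the probability of a digit that is at least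
  \<open>k\<close>, and \<open>digit_weight k\<close> below is the probability of the digit \<open>k\<close>.\<close>

definition log_weight :: "nat \<Rightarrow> real" where
  "log_weight k = ln (1 + 1 / real k)"

lemma log_weight_pos: "k > 0 \<Longrightarrow> log_weight k > 0"
  unfolding log_weight_def by (intro ln_gt_zero) auto

lemma log_weight_decreasing: "k > 0 \<Longrightarrow> log_weight (Suc k) < log_weight k"
  unfolding log_weight_def by (intro ln_less_cancel_iff[THEN iffD2] add_pos_pos add_strict_left_mono divide_strict_left_mono) auto

lemma log_weight_lim: "log_weight \<longlonglongrightarrow> 0"
  unfolding log_weight_def by real_asymp

lemma log_weight_asymp: "(\<lambda>N. real N * log_weight N) \<longlonglongrightarrow> 1"
  unfolding log_weight_def by real_asymp

definition digit_weight :: "nat \<Rightarrow> real" where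
  "digit_weight k = log_weight k - log_weight (Suc k)"

lemma digit_weight_pos: "k > 0 \<Longrightarrow> digit_weight k > 0"
  using log_weight_decreasing by (simp add: digit_weight_def)

lemma sums_shift_telescope:
  fixes f :: "nat \<Rightarrow> real"
  assumes "f \<longlonglongrightarrow> 0"
  shows "(\<lambda>i. f (N + i) - f (Suc (N + i))) sums f N"
  using telescope_sums'[of "\<lambda>i. f (N + i)" 0] LIMSEQ_ignore_initial_segment[OF assms, of N]
  by (simp add: add.commute)

lemma digit_weight_sums: "(\<lambda>i. digit_weight (N + i)) sums log_weight N"
  unfolding digit_weight_def using sums_shift_telescope[OF log_weight_lim] .

text \<open>The terms are of order \<open>k\<^sup>r\<^sup>-\<^sup>2\<close>; the telescoping comparison series has the terms
  \<open>k\<^sup>r\<^sup>-\<^sup>1 - (k + 1)\<^sup>r\<^sup>-\<^sup>1\<close>, which behave like \<open>(1 - r) k\<^sup>r\<^sup>-\<^sup>2\<close>.\<close>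

lemma
  assumes "r < 1"
  shows summable_powr_digit_weight: "summable (\<lambda>k. real k powr r * digit_weight k)"
    and powr_tail_asymp: "(\<lambda>N. (\<Sum>i. real (N + i) powr r * digit_weight (N + i)) / real N powr (r - 1)) \<longlonglongrightarrow> 1 / (1 - r)"
proof -
  define b where "b = (\<lambda>k::nat. real k powr (r - 1) - real (Suc k) powr (r - 1))"
  have l0: "(\<lambda>k::nat. real k powr (r - 1)) \<longlonglongrightarrow> 0"
    using assms by (intro tendsto_neg_powr filterlim_real_sequentially) auto
  have bs: "(\<lambda>i. b (N + i)) sums real N powr (r - 1)" for N
    unfolding b_def by (rule sums_shift_telescope[OF l0])
  have bp: "b k > 0" if "k > 0" for k
    unfolding b_def using that assms by (auto intro!: powr_less_mono2_neg)
  \<comment> \<open>The ratio of the terms, with the power \<open>k powr (r - 1)\<close> cancelled.\<close>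
  have "((\<lambda>x::real. x * (ln (1 + 1 / x) - ln (1 + 1 / (x + 1))) / (1 - (1 + 1 / x) powr (r - 1))) \<longlongrightarrow> 1 / (1 - r)) at_top"
    using assms by real_asymp (simp add: inverse_eq_divide)
  then have "(\<lambda>k::nat. real k * (ln (1 + 1 / real k) - ln (1 + 1 / (real k + 1))) / (1 - (1 + 1 / real k) powr (r - 1))) \<longlonglongrightarrow> 1 / (1 - r)"
    by (rule filterlim_compose[OF _ filterlim_real_sequentially])
  moreover have "\<forall>\<^sub>F k in sequentially. real k * (ln (1 + 1 / real k) - ln (1 + 1 / (real k + 1))) / (1 - (1 + 1 / real k) powr (r - 1))
       = (real k powr r * digit_weight k) / b k"
    using eventually_gt_at_top[of 0]
  proof eventually_elim
    case (elim k)
    have "real (Suc k) = real k * (1 + 1 / real k)" using elim by (simp add: field_simps)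
    then have "real (Suc k) powr (r - 1) = real k powr (r - 1) * (1 + 1 / real k) powr (r - 1)"
      by (simp only: powr_mult)
    then have "b k = real k powr (r - 1) * (1 - (1 + 1 / real k) powr (r - 1))"
      unfolding b_def by (simp add: algebra_simps)
    moreover have "real k powr r = real k powr (r - 1) * real k" using elim by (simp add: powr_diff)
    ultimately show ?case using elim by (simp add: digit_weight_def log_weight_def add.commute)
  qed
  ultimately have lim: "(\<lambda>k. (real k powr r * digit_weight k) / b k) \<longlonglongrightarrow> 1 / (1 - r)"
    by (rule Lim_transform_eventually)
  have "summable b" using bs[of 0] by (simp add: sums_iff)
  from tail_sum_ratio[OF bp this lim]
  show "summable (\<lambda>k. real k powr r * digit_weight k)"
    and "(\<lambda>N. (\<Sum>i. real (N + i) powr r * digit_weight (N + i)) / real N powr (r - 1)) \<longlonglongrightarrow> 1 / (1 - r)"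
    using bs by (simp_all add: sums_iff)
qed

lemma holder_const_eq:
  assumes "r < 1"
  shows "holder_const N r = ((\<Sum>i. real (N + i) powr r * digit_weight (N + i)) / log_weight N) powr (1 / r)"
proof -
  have "(\<Sum>i. let k = real (N + i) in k powr r * ((ln (1 + 1 / k) - ln (1 + 1 / (k + 1))) / ln (1 + 1 / real N)))
    = (\<Sum>i. real (N + i) powr r * digit_weight (N + i) / log_weight N)"
    by (simp add: Let_def digit_weight_def log_weight_def add_ac)
  also have "\<dots> = (\<Sum>i. real (N + i) powr r * digit_weight (N + i)) / log_weight N"
    using summable_ignore_initial_segment[OF summable_powr_digit_weight[OF assms], of N]
    by (intro suminf_divide) (simp add: add.commute)
  finally show ?thesis unfolding holder_const_def by simp
qed

theorem holder_const_asymp: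
  assumes "r < 1" "r \<noteq> 0"
  shows "(\<lambda>N. holder_const N r / real N) \<longlonglongrightarrow> (1 - r) powr (- 1 / r)"
proof -
  define A where "A = (\<lambda>N. \<Sum>i. real (N + i) powr r * digit_weight (N + i))"
  have "(\<lambda>N. A N / real N powr (r - 1) / (real N * log_weight N)) \<longlonglongrightarrow> 1 / (1 - r) / 1"
    unfolding A_def by (intro tendsto_divide powr_tail_asymp log_weight_asymp assms one_neq_zero)
  then have "(\<lambda>N. (A N / real N powr (r - 1) / (real N * log_weight N)) powr (1 / r)) \<longlonglongrightarrow> (1 / (1 - r) / 1) powr (1 / r)"
    using assms by (intro tendsto_powr tendsto_const) auto
  moreover have "\<forall>\<^sub>F N in sequentially. (A N / real N powr (r - 1) / (real N * log_weight N)) powr (1 / r) = holder_const N r / real N"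
    using eventually_gt_at_top[of 0]
  proof eventually_elim
    case (elim N)
    have "A N / real N powr (r - 1) / (real N * log_weight N) = (A N / log_weight N) / real N powr r"
      using elim by (simp add: powr_diff)
    also have "\<dots> powr (1 / r) = (A N / log_weight N) powr (1 / r) / (real N powr r) powr (1 / r)"
      by (rule powr_divide)
    also have "(real N powr r) powr (1 / r) = real N" using assms elim by (simp add: powr_powr)
    finally show ?case by (simp add: holder_const_eq assms A_def)
  qed
  ultimately have "(\<lambda>N. holder_const N r / real N) \<longlonglongrightarrow> (1 / (1 - r) / 1) powr (1 / r)"
    by (rule Lim_transform_eventually)
  also have "(1 / (1 - r) / 1) powr (1 / r) = (1 - r) powr (- 1 / r)"
    using assms by (simp add: powr_divide powr_minus_divide)
  finally show ?thesis .
qed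

text \<open>Summation by parts: subtracting the telescoping terms \<open>ln k \<cdot> w k - ln (k + 1) \<cdot> w (k + 1)\<close>, where
  \<open>w = log_weight\<close>, leaves \<open>w k \<cdot> w (k + 1)\<close>, because \<open>ln (k + 1) - ln k = w k\<close>. The telescoping part
  contributes exactly \<open>ln N\<close> to the logarithm of the geometric constant, and the remainder contributes
  \<open>1\<close> in the limit: its terms are asymptotic to those of \<open>digit_weight\<close>, whose tail is \<open>log_weight N\<close>.\<close>

lemma ln_digit_weight_sums:
  assumes "N > 0"
  shows "(\<lambda>i. ln (real (N + i)) * digit_weight (N + i)) sums
    ((\<Sum>i. log_weight (N + i) * log_weight (Suc (N + i))) + ln (real N) * log_weight N)"
    and ln_tail_asymp: "(\<lambda>N. (\<Sum>i. log_weight (N + i) * log_weight (Suc (N + i))) / log_weight N) \<longlonglongrightarrow> 1"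
proof -
  have lim: "(\<lambda>k. log_weight k * log_weight (Suc k) / digit_weight k) \<longlonglongrightarrow> 1"
    unfolding digit_weight_def log_weight_def of_nat_Suc by real_asymp
  have sd: "summable digit_weight" using digit_weight_sums[of 0] by (simp add: sums_iff)
  note t = tail_sum_ratio[OF digit_weight_pos sd lim]
  show "(\<lambda>N. (\<Sum>i. log_weight (N + i) * log_weight (Suc (N + i))) / log_weight N) \<longlonglongrightarrow> 1"
    using t(2) digit_weight_sums by (simp add: sums_iff)
  have "(\<lambda>k. ln (real k) * log_weight k) \<longlonglongrightarrow> 0" unfolding log_weight_def by real_asymp
  from sums_shift_telescope[OF this, of N]
  have "(\<lambda>i. ln (real (N + i)) * log_weight (N + i) - ln (real (Suc (N + i))) * log_weight (Suc (N + i))) sums (ln (real N) * log_weight N)" .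
  moreover have "(\<lambda>i. log_weight (N + i) * log_weight (Suc (N + i))) sums (\<Sum>i. log_weight (N + i) * log_weight (Suc (N + i)))"
    using summable_ignore_initial_segment[OF t(1), of N] by (intro summable_sums) (simp add: add.commute)
  ultimately have sm: "(\<lambda>i. log_weight (N + i) * log_weight (Suc (N + i)) + 
     (ln (real (N + i)) * log_weight (N + i) - ln (real (Suc (N + i))) * log_weight (Suc (N + i)))) sums
    ((\<Sum>i. log_weight (N + i) * log_weight (Suc (N + i))) + ln (real N) * log_weight N)"
    by (intro sums_add)
  have e: "log_weight k * log_weight (Suc k) + (ln (real k) * log_weight k - ln (real (Suc k)) * log_weight (Suc k)) = ln (real k) * digit_weight k"
    if "k > 0" for k
  proof -
    have "1 + 1 / real k = real (Suc k) / real k" using that by (simp add: field_simps)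
    then have "log_weight k = ln (real (Suc k)) - ln (real k)"
      unfolding log_weight_def using that by (simp add: ln_div)
    then have "ln (real (Suc k)) = ln (real k) + log_weight k" by simp
    then show ?thesis unfolding digit_weight_def by (simp only:) (simp add: algebra_simps)
  qed
  have "(\<lambda>i. log_weight (N + i) * log_weight (Suc (N + i)) + 
     (ln (real (N + i)) * log_weight (N + i) - ln (real (Suc (N + i))) * log_weight (Suc (N + i)))) =
     (\<lambda>i. ln (real (N + i)) * digit_weight (N + i))"
    using assms by (intro ext e) simp
  then show "(\<lambda>i. ln (real (N + i)) * digit_weight (N + i)) sums
    ((\<Sum>i. log_weight (N + i) * log_weight (Suc (N + i))) + ln (real N) * log_weight N)"
    using sm by (simp only:)
qed

text \<open>Each factor of the product is an exponential, since \<open>(k + 1)\<^sup>2 / (k (k + 2))\<close> is the quotient of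
  \<open>1 + 1/k\<close> and \<open>1 + 1/(k + 1)\<close>.\<close>

lemma geom_const_eq:
  assumes "N > 0"
  shows "geom_const N = exp ((\<Sum>i. ln (real (N + i)) * digit_weight (N + i)) / log_weight N)"
proof -
  have s: "summable (\<lambda>i. ln (real (N + i)) * digit_weight (N + i))"
    using ln_digit_weight_sums[OF assms] by (simp add: sums_iff)
  have "geom_const N = (\<Prod>i. exp (ln (real (N + i)) * digit_weight (N + i) / log_weight N))"
    unfolding geom_const_def
  proof (intro arg_cong[where f=prodinf] ext)
    fix i
    define k where "k = N + i"
    have k: "real k > 0" using assms by (simp add: k_def)
    have "(real k + 1)\<^sup>2 / (real k * (real k + 2)) = (1 + 1 / real k) / (1 + 1 / (real k + 1))"
      using k by (simp add: divide_simps) (simp add: power2_eq_square algebra_simps)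
    moreover have "1 + 1 / real k > 0" "1 + 1 / (real k + 1) > 0" using k by (simp_all add: add_pos_pos)
    ultimately have "ln ((real k + 1)\<^sup>2 / (real k * (real k + 2))) = digit_weight k"
      by (simp add: ln_div digit_weight_def log_weight_def add.commute)
    moreover have "ln (real N + 1) - ln (real N) = log_weight N"
    proof -
      have "1 + 1 / real N = (real N + 1) / real N" using assms by (simp add: field_simps)
      then show ?thesis unfolding log_weight_def using assms by (simp add: ln_div)
    qed
    ultimately have "((real k + 1)\<^sup>2 / (real k * (real k + 2))) powr (ln (real k) / (ln (real N + 1) - ln (real N)))
       = exp (ln (real k) * digit_weight k / log_weight N)"
      using k by (simp add: powr_def)
    then show "(let k = real (N + i) in ((k + 1)\<^sup>2 / (k * (k + 2))) powr (ln k / (ln (real N + 1) - ln (real N))))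
      = exp (ln (real (N + i)) * digit_weight (N + i) / log_weight N)"
      by (simp add: Let_def k_def)
  qed
  also have "\<dots> = exp (\<Sum>i. ln (real (N + i)) * digit_weight (N + i) / log_weight N)"
    by (rule prodinf_exp) (rule summable_divide[OF s])
  also have "(\<Sum>i. ln (real (N + i)) * digit_weight (N + i) / log_weight N) = (\<Sum>i. ln (real (N + i)) * digit_weight (N + i)) / log_weight N"
    by (rule suminf_divide[OF s])
  finally show ?thesis .
qed

theorem geom_const_asymp: "(\<lambda>N. geom_const N / real N) \<longlonglongrightarrow> exp 1"
proof (rule Lim_transform_eventually)
  let ?R = "\<lambda>N. (\<Sum>i. log_weight (N + i) * log_weight (Suc (N + i))) / log_weight N"
  show "(\<lambda>N. exp (?R N)) \<longlonglongrightarrow> exp 1" by (intro tendsto_exp ln_tail_asymp[of 1]) simp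
  show "\<forall>\<^sub>F N in sequentially. exp (?R N) = geom_const N / real N"
    using eventually_gt_at_top[of 0]
  proof eventually_elim
    case (elim N)
    have "geom_const N = exp (?R N + ln (real N))"
      using ln_digit_weight_sums(1)[OF elim] log_weight_pos[OF elim]
      by (simp add: geom_const_eq[OF elim] sums_iff add_divide_distrib)
    then show ?case using elim by (simp add: exp_add)
  qed
qed

section \<open>Limits of the Hoelder means\<close>

lemma ereal_powr_ereal:
  assumes "a > 0"
  shows "ereal_powr (ereal a) r = ereal (a powr r)"
  using assms by (simp add: ereal_powr_def)

lemma holder_mean_finite_digits:
  assumes dig: "\<And>j. ncf_digit N x (Suc j) = ereal (real (d j))" and d: "\<And>j. d j > 0" and n: "n > 0"
  shows "r \<noteq> 0 \<Longrightarrow> holder_mean N r x n = ereal (((\<Sum>j<n. real (d j) powr r) / n) powr (1 / r))"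
    and "holder_mean N 0 x n = ereal (exp ((\<Sum>j<n. ln (real (d j))) / n))"
proof -
  assume r: "r \<noteq> 0"
  have "(\<Sum>j=1..n. ereal_powr (ncf_digit N x j) r) = (\<Sum>j<n. ereal_powr (ncf_digit N x (Suc j)) r)"
    by (simp add: sum.atLeast1_atMost_eq lessThan_atLeast0)
  also have "\<dots> = ereal (\<Sum>j<n. real (d j) powr r)"
    using d by (simp add: dig ereal_powr_ereal)
  finally have e: "(\<Sum>j=1..n. ereal_powr (ncf_digit N x j) r) = ereal (\<Sum>j<n. real (d j) powr r)" .
  have "0 < (\<Sum>j<n. real (d j) powr r) / n"
    using d n by (intro divide_pos_pos sum_pos) (auto simp: lessThan_empty_iff less_imp_neq)
  then show "holder_mean N r x n = ereal (((\<Sum>j<n. real (d j) powr r) / n) powr (1 / r))"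
    using r n unfolding holder_mean_def e by (simp add: ereal_powr_ereal)
next
  have "(\<Prod>j=1..n. ncf_digit N x j) = (\<Prod>j<n. ncf_digit N x (Suc j))"
    by (simp add: prod.atLeast1_atMost_eq lessThan_atLeast0)
  also have "\<dots> = ereal (\<Prod>j<n. real (d j))"
    by (simp add: dig prod_ereal)
  finally have e: "(\<Prod>j=1..n. ncf_digit N x j) = ereal (\<Prod>j<n. real (d j))" .
  have p: "0 < (\<Prod>j<n. real (d j))" using d by (intro prod_pos) auto
  have "ln (\<Prod>j<n. real (d j)) = (\<Sum>j<n. ln (real (d j)))"
    using d by (intro ln_prod) auto
  then show "holder_mean N 0 x n = ereal (exp ((\<Sum>j<n. ln (real (d j))) / n))"
    using p d unfolding holder_mean_def e by (simp add: ereal_powr_ereal powr_def)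
qed

text \<open>All limits hold at any single point whose digits are finite, have the right frequencies and have
  bounded power averages for exponents arbitrarily close to \<open>1\<close>. The hypotheses are countably many
  and do not mention \<open>r\<close>, so the exceptional null set does not depend on \<open>r\<close>.\<close>

lemma holder_mean_limits:
  fixes d :: "nat \<Rightarrow> nat"
  assumes N: "N > 0"
    and dig: "\<And>j. ncf_digit N x (Suc j) = ereal (real (d j))" and d: "\<And>j. d j \<ge> N"
    and freq: "\<And>k. k \<ge> N \<Longrightarrow> (\<lambda>n. (\<Sum>j<n. of_bool (k \<le> d j)) / n) \<longlonglongrightarrow> log_weight k / log_weight N"
    and bound: "\<And>m::nat. \<exists>B. \<forall>n. (\<Sum>j<n. real (d j) powr (1 - 1 / real (m + 2))) \<le> B * real n"
  shows "r \<ge> 1 \<Longrightarrow> holder_mean N r x \<longlonglongrightarrow> \<infinity>"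
    and "r < 1 \<Longrightarrow> r \<noteq> 0 \<Longrightarrow> holder_mean N r x \<longlonglongrightarrow> ereal (holder_const N r)"
    and "holder_mean N 0 x \<longlonglongrightarrow> ereal (geom_const N)"
proof -
  have d0: "d j > 0" for j using d[of j] N by simp
  note mean = holder_mean_finite_digits[OF dig d0]
  have lN: "log_weight N > 0" using log_weight_pos[OF N] .
  define p where "p = (\<lambda>k. if k < N then 0 else digit_weight k / log_weight N)"
  have fp: "(\<lambda>n. (\<Sum>j<n. of_bool (d j = k)) / n) \<longlonglongrightarrow> p k" for k
  proof (cases "k < N")
    case True
    then have "d j \<noteq> k" for j using d[of j] by auto
    then show ?thesis using True by (simp add: p_def)
  next
    case False
    then have "(\<lambda>n. (\<Sum>j<n. of_bool (k \<le> d j)) / real n - (\<Sum>j<n. of_bool (Suc k \<le> d j)) / real n)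
      \<longlonglongrightarrow> log_weight k / log_weight N - log_weight (Suc k) / log_weight N"
      by (intro tendsto_diff freq) auto
    moreover have "(\<Sum>j<n. of_bool (k \<le> d j)) / real n - (\<Sum>j<n. of_bool (Suc k \<le> d j)) / real n = (\<Sum>j<n. of_bool (d j = k)) / n" for n
      unfolding diff_divide_distrib[symmetric] sum_subtractf[symmetric]
      by (intro arg_cong2[where f="(/)"] sum.cong) auto
    ultimately show ?thesis using False by (simp add: p_def digit_weight_def diff_divide_distrib)
  qed
  have avg: "(\<lambda>n. (\<Sum>j<n. \<phi> (d j)) / n) \<longlonglongrightarrow> (\<Sum>i. \<phi> (N + i) * digit_weight (N + i)) / log_weight N"
    "summable (\<lambda>i. \<phi> (N + i) * digit_weight (N + i))"
    if \<phi>: "\<And>k. \<bar>\<phi> k\<bar> \<le> C * real k powr r" and r: "r < 1" for \<phi> C r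
  proof -
    \<comment> \<open>An exponent strictly between \<open>r\<close> and \<open>1\<close> for which the power averages are bounded.\<close>
    obtain m :: nat where m: "1 / real (m + 2) < 1 - r"
    proof -
      obtain n :: nat where "inverse (real (Suc n)) < 1 - r" using reals_Archimedean[of "1 - r"] r by auto
      moreover have "1 / real (n + 2) \<le> inverse (real (Suc n))" by (simp add: field_simps)
      ultimately show ?thesis using that by (meson le_less_trans)
    qed
    obtain B where B: "\<And>n. (\<Sum>j<n. real (d j) powr (1 - 1 / real (m + 2))) \<le> B * real n"
      using bound by blast
    have rs: "r < 1 - 1 / real (m + 2)" using m by simp
    note A = averages_of_digit_function[OF fp B \<phi> rs]
    have sh: "p (i + N) * \<phi> (i + N) = \<phi> (N + i) * digit_weight (N + i) / log_weight N" for i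
      by (simp add: p_def add.commute)
    have "summable (\<lambda>i. p (i + N) * \<phi> (i + N))" using A(1) by (rule summable_ignore_initial_segment)
    then have "summable (\<lambda>i. \<phi> (N + i) * digit_weight (N + i) / log_weight N * log_weight N)"
      unfolding sh by (rule summable_mult2)
    then show s: "summable (\<lambda>i. \<phi> (N + i) * digit_weight (N + i))" using lN by simp
    have "(\<Sum>k. p k * \<phi> k) = (\<Sum>i. p (i + N) * \<phi> (i + N)) + (\<Sum>k<N. p k * \<phi> k)"
      by (rule suminf_split_initial_segment[OF A(1)])
    also have "(\<Sum>k<N. p k * \<phi> k) = 0" by (simp add: p_def)
    also have "(\<Sum>i. p (i + N) * \<phi> (i + N)) = (\<Sum>i. \<phi> (N + i) * digit_weight (N + i)) / log_weight N"
      unfolding sh by (rule suminf_divide[OF s])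
    finally show "(\<lambda>n. (\<Sum>j<n. \<phi> (d j)) / n) \<longlonglongrightarrow> (\<Sum>i. \<phi> (N + i) * digit_weight (N + i)) / log_weight N"
      using A(2) by simp
  qed
  have ev: "\<forall>\<^sub>F n in sequentially. n > (0::nat)" by (rule eventually_gt_at_top)

  show "holder_mean N r x \<longlonglongrightarrow> \<infinity>" if r: "r \<ge> 1"
  proof -
    have "filterlim (\<lambda>K. \<Sum>i<K. log_weight (N + i) / log_weight N) at_top sequentially"
    proof -
      have "(\<Sum>i<K. log_weight (N + i) / log_weight N) = (ln (real (N + K)) - ln (real N)) / log_weight N" for K
      proof -
        have "log_weight (N + i) = ln (real (N + Suc i)) - ln (real (N + i))" for i
        proof -
          have "1 + 1 / real (N + i) = real (N + Suc i) / real (N + i)" using N by (simp add: field_simps)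
          then show ?thesis unfolding log_weight_def using N by (simp add: ln_div)
        qed
        then show ?thesis
          using sum_lessThan_telescope[of "\<lambda>i. ln (real (N + i))" K] by (simp flip: sum_divide_distrib)
      qed
      moreover have "filterlim (\<lambda>K. (ln (real (N + K)) - ln (real N)) / log_weight N) at_top sequentially"
        unfolding of_nat_add using lN by real_asymp
      ultimately show ?thesis by simp
    qed
    from averages_of_powers_at_top[OF freq this N r]
    have "filterlim (\<lambda>n. (\<Sum>j<n. real (d j) powr r) / n) at_top sequentially" by simp
    moreover have "filterlim (\<lambda>x::real. x powr (1 / r)) at_top at_top" using r by real_asymp
    ultimately have "filterlim (\<lambda>n. ((\<Sum>j<n. real (d j) powr r) / n) powr (1 / r)) at_top sequentially"
      by (rule filterlim_compose[rotated])
    then have "(\<lambda>n. ereal (((\<Sum>j<n. real (d j) powr r) / n) powr (1 / r))) \<longlonglongrightarrow> \<infinity>"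
      by (simp add: tendsto_PInfty_eq_at_top)
    moreover have "\<forall>\<^sub>F n in sequentially. ereal (((\<Sum>j<n. real (d j) powr r) / n) powr (1 / r)) = holder_mean N r x n"
      using ev by eventually_elim (use mean(1) r in simp)
    ultimately show ?thesis by (rule Lim_transform_eventually)
  qed

  show "holder_mean N r x \<longlonglongrightarrow> ereal (holder_const N r)" if r: "r < 1" "r \<noteq> 0"
  proof -
    let ?S = "(\<Sum>i. real (N + i) powr r * digit_weight (N + i)) / log_weight N"
    have pw: "\<bar>real k powr r\<bar> \<le> 1 * real k powr r" for k by simp
    note A = avg[of "\<lambda>k. real k powr r", OF pw r(1)]
    have "?S > 0"
      using digit_weight_pos N lN A(2) by (intro divide_pos_pos suminf_pos mult_pos_pos) auto
    then have "(\<lambda>n. ((\<Sum>j<n. real (d j) powr r) / n) powr (1 / r)) \<longlonglongrightarrow> ?S powr (1 / r)"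
      by (intro tendsto_powr A(1) tendsto_const) auto
    then have "(\<lambda>n. ereal (((\<Sum>j<n. real (d j) powr r) / n) powr (1 / r))) \<longlonglongrightarrow> ereal (holder_const N r)"
      using r by (simp add: holder_const_eq)
    moreover have "\<forall>\<^sub>F n in sequentially. ereal (((\<Sum>j<n. real (d j) powr r) / n) powr (1 / r)) = holder_mean N r x n"
      using ev by eventually_elim (use mean(1) r in simp)
    ultimately show ?thesis by (rule Lim_transform_eventually)
  qed

  show "holder_mean N 0 x \<longlonglongrightarrow> ereal (geom_const N)"
  proof -
    have ln_bound: "\<bar>ln (real k)\<bar> \<le> 2 * real k powr (1 / 2)" for k
    proof (cases "k = 0")
      case False
      then show ?thesis using ln_powr_bound[of "real k" "1 / 2"] by simp
    qed simp
    have "(\<lambda>n. exp ((\<Sum>j<n. ln (real (d j))) / n)) \<longlonglongrightarrow> geom_const N"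
      unfolding geom_const_eq[OF N] by (intro tendsto_exp avg(1)[OF ln_bound]) simp
    then have "(\<lambda>n. ereal (exp ((\<Sum>j<n. ln (real (d j))) / n))) \<longlonglongrightarrow> ereal (geom_const N)" by simp
    moreover have "\<forall>\<^sub>F n in sequentially. ereal (exp ((\<Sum>j<n. ln (real (d j))) / n)) = holder_mean N 0 x n"
      using ev by eventually_elim (use mean(2) in simp)
    ultimately show ?thesis by (rule Lim_transform_eventually)
  qed
qed

context ncf begin

lemma AE_holder_mean_limits:
  "AE x in \<mu>.
     (\<forall>r. r \<ge> 1 \<longrightarrow> holder_mean N r x \<longlonglongrightarrow> \<infinity>) \<and>
     (\<forall>r. r < 1 \<and> r \<noteq> 0 \<longrightarrow> holder_mean N r x \<longlonglongrightarrow> ereal (holder_const N r)) \<and>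
     holder_mean N 0 x \<longlonglongrightarrow> ereal (geom_const N)"
proof -
  have "AE x in \<mu>. 0 < (T ^^ j) x \<and> (T ^^ j) x < 1" for j
  proof -
    have "AE x in distr \<mu> borel (T ^^ j). 0 < x \<and> x < 1"
      unfolding distr_funpow_T by (rule AE_\<mu>_unit)
    then show ?thesis by (subst (asm) AE_distr_iff) auto
  qed
  then have orbit: "AE x in \<mu>. \<forall>j. 0 < (T ^^ j) x \<and> (T ^^ j) x < 1"
    by (simp add: AE_all_countable)
  have "AE x in \<mu>. k \<ge> N \<longrightarrow> (\<lambda>n. (\<Sum>j<n. indicator {..N / k} ((T ^^ j) x)) / n)
           \<longlonglongrightarrow> ln (1 + 1 / k) / ln (1 + 1 / N)" for k :: nat
    using AE_frequency[of k] by (cases "k \<ge> N") auto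
  then have freq: "AE x in \<mu>. \<forall>k. k \<ge> N \<longrightarrow> (\<lambda>n. (\<Sum>j<n. indicator {..N / k} ((T ^^ j) x)) / n)
           \<longlonglongrightarrow> ln (1 + 1 / k) / ln (1 + 1 / N)"
    by (simp add: AE_all_countable)
  have "AE x in \<mu>. \<exists>B. \<forall>n. (\<Sum>j<n. (real N / (T ^^ j) x) powr (1 - 1 / real (m + 2))) \<le> B * real n" for m :: nat
    by (intro AE_power_sums_bounded) auto
  then have bound: "AE x in \<mu>. \<forall>m::nat. \<exists>B. \<forall>n. (\<Sum>j<n. (real N / (T ^^ j) x) powr (1 - 1 / real (m + 2))) \<le> B * real n"
    unfolding AE_all_countable by blast
  show ?thesis
    using orbit freq bound
  proof eventually_elim
    case (elim x)
    define d where "d = (\<lambda>j. nat \<lfloor>real N / (T ^^ j) x\<rfloor>)"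
    have y: "0 < (T ^^ j) x" "(T ^^ j) x < 1" for j using elim(1) by auto
    have dige: "k \<le> d j \<longleftrightarrow> (T ^^ j) x \<le> N / k" if "k > 0" for k j
      using y[of j] that by (simp add: d_def le_nat_iff le_floor_iff field_simps)
    have "N \<le> d j" for j
      using dige[of N j] N_pos y[of j] by simp
    moreover have "ncf_digit N x (Suc j) = ereal (real (d j))" for j
      using y[of j] by (simp add: ncf_digit_def d_def)
    moreover have "(\<lambda>n. (\<Sum>j<n. of_bool (k \<le> d j)) / n) \<longlonglongrightarrow> log_weight k / log_weight N" if "k \<ge> N" for k
    proof -
      have "of_bool (k \<le> d j) = (indicator {..N / k} ((T ^^ j) x) :: real)" for j
        using dige[of k j] that N_pos by (auto simp: indicator_def)
      then show ?thesis using elim(2) that by (simp add: log_weight_def)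
    qed
    moreover have "\<exists>B. \<forall>n. (\<Sum>j<n. real (d j) powr (1 - 1 / real (m + 2))) \<le> B * real n" for m :: nat
    proof -
      obtain B where B: "\<And>n. (\<Sum>j<n. (real N / (T ^^ j) x) powr (1 - 1 / real (m + 2))) \<le> B * real n"
        using elim(3) by blast
      have "(\<Sum>j<n. real (d j) powr (1 - 1 / real (m + 2))) \<le> (\<Sum>j<n. (real N / (T ^^ j) x) powr (1 - 1 / real (m + 2)))" for n
      proof (intro sum_mono powr_mono2)
        show "real (d j) \<le> real N / (T ^^ j) x" for j
          using y[of j] by (simp add: d_def)
      qed auto
      then show ?thesis using B by (meson order_trans)
    qed
    ultimately show ?case using holder_mean_limits[OF N_pos] by blast
  qed
qed

end

theorem theorem4p5:
  shows "(\<forall>N::nat. N > 0 \<longrightarrow>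
            (AE x in lebesgue_on {0..<1}.
               (\<forall>r::real. r \<ge> 1 \<longrightarrow> holder_mean N r x \<longlonglongrightarrow> \<infinity>) \<and>
               (\<forall>r::real. r < 1 \<and> r \<noteq> 0 \<longrightarrow> holder_mean N r x \<longlonglongrightarrow> ereal (holder_const N r)) \<and>
               holder_mean N 0 x \<longlonglongrightarrow> ereal (geom_const N))) \<and>
         (\<forall>r::real. r < 1 \<and> r \<noteq> 0 \<longrightarrow>
            (\<lambda>N. holder_const N r / real N) \<longlonglongrightarrow> (1 - r) powr (- 1 / r)) \<and>
         (\<lambda>N. geom_const N / real N) \<longlonglongrightarrow> exp 1"
proof (intro conjI allI impI)
  fix N :: nat assume "N > 0"
  then interpret ncf N by unfold_locales
  let ?P = "\<lambda>x. (\<forall>r::real. r \<ge> 1 \<longrightarrow> holder_mean N r x \<longlonglongrightarrow> \<infinity>) \<and>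
               (\<forall>r::real. r < 1 \<and> r \<noteq> 0 \<longrightarrow> holder_mean N r x \<longlonglongrightarrow> ereal (holder_const N r)) \<and>
               holder_mean N 0 x \<longlonglongrightarrow> ereal (geom_const N)"
  have "AE x in lborel. x \<in> {0<..<1} \<longrightarrow> ?P x"
    using AE_holder_mean_limits unfolding AE_\<mu>_iff .
  then have "AE x in lborel. x \<in> {0..<1} \<longrightarrow> ?P x"
    using AE_lborel_singleton[of "0::real"] by eventually_elim auto
  then have "AE x in lebesgue. x \<in> {0..<1} \<longrightarrow> ?P x"
    by (rule AE_completion)
  then show "AE x in lebesgue_on {0..<1}. ?P x"
    by (subst AE_restrict_space_iff) auto
qed (use holder_const_asymp geom_const_asymp in auto)

end
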